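(* Let $m,N\ge 1$ be integers and let $R_1,\dots,R_m$ be $N\times N$ real matrices. Consider the deterministic cyclic interacting urn model with $m$ urns, $N$ colors and replacement matrices $R_1,\dots,R_m$ (described in the context), with at least one ball in each urn initially. Let $R$ be the $Nm\times Nm$ block matrix $$R=\begin{pmatrix} 0&R_2&0& \cdots &0 \\ 0&0&R_3& \cdots &0\\ \vdots & \vdots & \vdots & \ddots & \vdots\\ 0&0&0& \cdots &R_m\\ R_1&0&0& \cdots &0 \end{pmatrix},$$ that is, with $N\times N$ blocks, block $(i,i+1)$ equals $R_{i+1}$ for $1\le i\le m-1$, block $(m,1)$ equals $R_1$, and all other blocks are $0$. Assume that (i) for each $i=1,\dots,m$, all entries of $R_i$ are non-negative and each row of $R_i$ sums to $1$; (ii) $R$ is an irreducible matrix. Let $C_n^i\in\mathbb{R}^N$ (row vector) denote the composition vector of urn $i$ at the $n$-th stage, and set $A_k^i=\frac{1}{k}\,C^i_{m(k-1)+i-1}$ for $i=1,\dots,m$ and $k\ge 1$. Then for every $i=1,\dots,m$, $$A_t^i\longrightarrow \pi_{(R_{i+1}R_{i+2}\cdots R_mR_1\cdots R_i)}\quad\text{almost surely as } t\to\infty,$$ where $\pi_{(R_{i+1}R_{i+2}\cdots R_mR_1\cdots R_i)}$ is the left eigenvector, normalized so that its entries sum to $1$, of the matrix $R_{i+1}R_{i+2}\cdots R_mR_1\cdots R_i$ corresponding to the eigenvalue $1$ (for $i=m$ this matrix is $R_1R_2\cdots R_m$). Moreover, all the entries of $\pi_{(R_{i+1}R_{i+2}\cdots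 R_mR_1\cdots R_i)}$ are strictly positive.
   Context: Deterministic cyclic interacting urn model: there are $m$ urns, each of which may contain balls of $N$ colors. The composition vector of an urn is the row vector in $\mathbb{R}^N$ whose $j$-th entry is the amount (possibly non-integer) of color $j$ in the urn. $C_0^i$ is the (deterministic, non-negative) initial composition of urn $i$, and $C_n^i$ is the composition of urn $i$ after $n$ steps. The urns are sampled cyclically: at step $n=mk+r$ with $k\ge 0$, $1\le r\le m$, a ball is drawn at random from urn $r$ (conditionally on the past, color $j$ is drawn with probability equal to the current proportion of color $j$ in urn $r$). If the drawn color is $j$, then the $j$-th row of $R_{r+1}$ is added to the composition vector of urn $r+1$ (where urn $m+1$ means urn $1$ and $R_{m+1}=R_1$); all other urns, including the sampled one if different, are unchanged. An irreducible non-negative square matrix $B$ is one such that for all indices $a,b$ there is $k\in\mathbb{N}$ with $(B^k)_{ab}>0$. *)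

theory Defs
  imports
    "HOL-Probability.Conditional_Expectation"
    "HOL-Probability.Stopping_Time"
    "Jordan_Normal_Form.Char_Poly"
begin

unbundle no vec_syntax
hide_type (open) Finite_Cartesian_Product.vec
hide_const (open) Finite_Cartesian_Product.vec Finite_Cartesian_Product.mat
  Finite_Cartesian_Product.row

text \<open>
  Urns are numbered \<open>1, \<dots>, m\<close>; colours, like all indices into the vectors and matrices
  used here, are numbered from \<open>0\<close> to \<open>N - 1\<close>.
  Step \<open>n = m k + r\<close> with \<open>1 \<le> r \<le> m\<close> samples urn \<open>r\<close>.
\<close>

definition sampled_urn :: "nat \<Rightarrow> nat \<Rightarrow> nat" where
  "sampled_urn m n = (n - 1) mod m + 1"

definition next_urn :: "nat \<Rightarrow> nat \<Rightarrow> nat" where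
  "next_urn m r = (if r = m then 1 else r + 1)"

definition proportion :: "real vec \<Rightarrow> nat \<Rightarrow> real" where
  "proportion c j = c $ j / (\<Sum>k<dim_vec c. c $ k)"

text \<open>
  \<open>C0 i\<close> is the initial composition of urn \<open>i\<close>, \<open>draw n\<close> the colour drawn at step \<open>n \<ge> 1\<close>,
  \<open>C n i\<close> the composition of urn \<open>i\<close> after \<open>n\<close> steps, and \<open>F n\<close> the past up to and including
  step \<open>n\<close>. The \<open>C n i\<close> are determined by \<open>draw 1, \<dots>, draw n\<close>, so \<open>F n\<close> can for instance be
  the \<open>\<sigma>\<close>-algebra generated by these draws.
\<close>

locale cyclic_urn_model =
  prob_space M + filtration "space M" F
  for M :: "'a measure" and F :: "nat \<Rightarrow> 'a measure" +
  fixes m N :: nat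
    and R :: "nat \<Rightarrow> real mat"
    and C0 :: "nat \<Rightarrow> real vec"
    and draw :: "nat \<Rightarrow> 'a \<Rightarrow> nat"
    and C :: "nat \<Rightarrow> nat \<Rightarrow> 'a \<Rightarrow> real vec"
  assumes subalg: "subalgebra M (F n)"
    and replacement_carrier: "i \<in> {1..m} \<Longrightarrow> R i \<in> carrier_mat N N"
    and init_carrier: "i \<in> {1..m} \<Longrightarrow> C0 i \<in> carrier_vec N"
    and init_nonneg: "i \<in> {1..m} \<Longrightarrow> j < N \<Longrightarrow> C0 i $ j \<ge> 0"
    and draw_measurable: "n \<ge> 1 \<Longrightarrow> draw n \<in> measurable (F n) (count_space {..<N})"
    and composition_0:
      "\<omega> \<in> space M \<Longrightarrow> i \<in> {1..m} \<Longrightarrow> C 0 i \<omega> = C0 i"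
    and composition_step:
      "\<omega> \<in> space M \<Longrightarrow> i \<in> {1..m} \<Longrightarrow>
        C (Suc n) i \<omega> =
          (if i = next_urn m (sampled_urn m (Suc n))
           then C n i \<omega> + row (R i) (draw (Suc n) \<omega>)
           else C n i \<omega>)"
    and draw_prob:
      "j < N \<Longrightarrow>
        AE \<omega> in M. real_cond_exp M (F n) (indicator {\<omega> \<in> space M. draw (Suc n) \<omega> = j}) \<omega> =
          proportion (C n (sampled_urn m (Suc n)) \<omega>) j"

text \<open>
  In the \<open>Nm \<times> Nm\<close> matrix the position \<open>a\<close> lies in block number \<open>a div N + 1\<close>, at place
  \<open>a mod N\<close> of that block.
\<close>

definition cyclic_block_mat :: "nat \<Rightarrow> nat \<Rightarrow> (nat \<Rightarrow> real mat) \<Rightarrow> real mat" where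
  "cyclic_block_mat m N R =
    mat (N * m) (N * m) (\<lambda>(a, b).
      if b div N + 1 = next_urn m (a div N + 1)
      then R (b div N + 1) $$ (a mod N, b mod N)
      else 0)"

definition irreducible_nonneg_mat :: "real mat \<Rightarrow> bool" where
  "irreducible_nonneg_mat B \<longleftrightarrow>
    square_mat B \<and>
    (\<forall>a < dim_row B. \<forall>b < dim_row B. B $$ (a, b) \<ge> 0) \<and>
    (\<forall>a < dim_row B. \<forall>b < dim_row B. \<exists>k. (B ^\<^sub>m k) $$ (a, b) > 0)"

text \<open>The product \<open>R\<^sub>i\<^sub>+\<^sub>1 R\<^sub>i\<^sub>+\<^sub>2 \<cdots> R\<^sub>m R\<^sub>1 \<cdots> R\<^sub>i\<close>:\<close>

definition cyclic_prod :: "nat \<Rightarrow> nat \<Rightarrow> (nat \<Rightarrow> real mat) \<Rightarrow> nat \<Rightarrow> real mat" where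
  "cyclic_prod m N R i = foldr (\<lambda>k A. R k * A) ([i + 1..<m + 1] @ [1..<i + 1]) (1\<^sub>m N)"

text \<open>A left eigenvector (a row vector) of \<open>A\<close> is an eigenvector of the transpose of \<open>A\<close>.\<close>

definition normalized_left_eigenvector_1 :: "real mat \<Rightarrow> real vec \<Rightarrow> bool" where
  "normalized_left_eigenvector_1 A v \<longleftrightarrow>
    eigenvector (transpose_mat A) v 1 \<and> (\<Sum>j<dim_vec v. v $ j) = 1"

definition left_eigenvector_pi :: "real mat \<Rightarrow> real vec" where
  "left_eigenvector_pi A = (THE v. normalized_left_eigenvector_1 A v)"

definition scaled_composition ::
  "nat \<Rightarrow> (nat \<Rightarrow> nat \<Rightarrow> 'a \<Rightarrow> real vec) \<Rightarrow> nat \<Rightarrow> nat \<Rightarrow> 'a \<Rightarrow> real vec" where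
  "scaled_composition m C k i \<omega> = (1 / real k) \<cdot>\<^sub>v C (m * (k - 1) + i - 1) i \<omega>"

end

theory Submission
  imports Defs
begin

text \<open>
  Each urn receives total mass one per cycle, so the proportions in an urn and the scaled
  compositions are asymptotically equal, and by a strong law for bounded uncorrelated variables
  the drawn colours may be replaced by the proportions. Hence the proportions \<open>x\<^sub>k\<close>
  of all urns, collected in one row vector of length \<open>N m\<close>, and their running means \<open>z\<^sub>k\<close> satisfy
  \<open>x\<^sub>k\<^sub>+\<^sub>1 = z\<^sub>k R + o(1)\<close>, that is,
  \<open>z\<^sub>k\<^sub>+\<^sub>1 - z\<^sub>k = (z\<^sub>k R - z\<^sub>k + o(1)) / (k + 2)\<close>. Since \<open>R\<close> is an irreducible stochastic
  matrix, the weighted square distance to its stationary vector contracts along this recursion;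
  irreducibility suffices, even if \<open>R\<close> is periodic, because only the real parts of the
  eigenvalues of \<open>R - 1\<close> matter.
\<close>

section \<open>Averaging along an irreducible stochastic kernel\<close>

text \<open>The matrices enter through a kernel on pairs of urn and colour. Since each urn feeds
  exactly one urn, a row vector fixed by the block matrix amounts to a vector of one urn fixed by
  the cyclic product of that urn and carried around the cycle. Existence, uniqueness and positivity
  of the limit are therefore obtained for the block kernel, where irreducibility is assumed, and
  then restricted to one urn. A stationary vector of an irreducible kernel can only be normalised by
  one scalar; this serves all urns at once because row sums one give all its blocks the same mass.
  Timing is an obstacle: within a round, urns \<open>2\<close> to \<open>m\<close> are fed before
  they are sampled, urn \<open>1\<close> only at the end, so the raw recursions are shifted against
  each other by one round. The slow variation of the running means absorbs the shift. Convergence of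
  running means alone does not give convergence of the proportions; for that, the limit of the means
  is inserted into the recursion once more.\<close>

lemma prod_one_minus_harmonic_tendsto_0:
  fixes c :: real
  assumes c: "0 < c" "c \<le> 1"
  shows "(\<lambda>n. \<Prod>k<n. 1 - c / real (Suc k)) \<longlonglongrightarrow> 0"
proof (rule tendsto_sandwich[OF _ _ tendsto_const])
  show "\<forall>\<^sub>F n in sequentially. 0 \<le> (\<Prod>k<n. 1 - c / real (Suc k))"
    using c by (intro always_eventually allI prod_nonneg) (auto simp: field_simps)
  have le: "(\<Prod>k<n. 1 - c / real (Suc k)) \<le> exp (- (c * harm n))" for n
  proof -
    have "(\<Prod>k<n. 1 - c / real (Suc k)) \<le> (\<Prod>k<n. exp (- (c / real (Suc k))))"
    proof (rule prod_mono, intro conjI)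
      fix k
      show "0 \<le> 1 - c / real (Suc k)"
        using c by (auto simp: field_simps)
      show "1 - c / real (Suc k) \<le> exp (- (c / real (Suc k)))"
        using exp_ge_add_one_self[of "- (c / real (Suc k))"] by simp
    qed
    also have "\<dots> = exp (\<Sum>k<n. - (c / real (Suc k)))"
      by (simp add: exp_sum)
    also have "(\<Sum>k<n. - (c / real (Suc k))) = - (c * harm n)"
      unfolding harm_altdef by (simp add: sum_negf sum_distrib_left divide_inverse)
    finally show ?thesis .
  qed
  show "\<forall>\<^sub>F n in sequentially. (\<Prod>k<n. 1 - c / real (Suc k)) \<le> exp (- (c * harm n))"
    using le by simp
  have "filterlim (\<lambda>n. c * harm n) at_top sequentially"
    by (rule filterlim_tendsto_pos_mult_at_top[OF tendsto_const c(1) harm_at_top])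
  then have "filterlim (\<lambda>n. - (c * harm n)) at_bot sequentially"
    by (simp add: filterlim_uminus_at_bot)
  then show "(\<lambda>n. exp (- (c * harm n))) \<longlonglongrightarrow> (0::real)"
    by (rule filterlim_compose[OF exp_at_bot])
qed

text \<open>Once \<open>\<epsilon> k < c * \<delta>\<close>, the pull at level
  \<open>\<delta>\<close> beats the error, so the excess of \<open>V\<close> over
  \<open>\<delta>\<close> contracts by the factor \<open>1 - c / (k + 1)\<close>. The harmonic
  series diverges, which drives the product of these factors to 0.\<close>

lemma harmonic_recursion_tendsto_0:
  fixes V \<epsilon> :: "nat \<Rightarrow> real"
  assumes nonneg: "\<And>k. 0 \<le> V k"
    and c: "0 < c" "c < 1"
    and \<epsilon>: "\<epsilon> \<longlonglongrightarrow> 0"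
    and step: "\<And>k. V (Suc k) \<le> (1 - c / real (Suc k)) * V k + \<epsilon> k / real (Suc k)"
  shows "V \<longlonglongrightarrow> 0"
proof (rule LIMSEQ_I)
  fix r :: real assume r: "0 < r"
  define \<delta> where "\<delta> = r / 2"
  have \<delta>: "0 < \<delta>" using r by (simp add: \<delta>_def)
  have "\<forall>\<^sub>F k in sequentially. \<epsilon> k < c * \<delta>"
    using order_tendstoD(2)[OF \<epsilon>, of "c * \<delta>"] c \<delta> by simp
  then obtain K where K: "\<And>k. k \<ge> K \<Longrightarrow> \<epsilon> k < c * \<delta>"
    by (auto simp: eventually_sequentially)
  let ?p = "\<lambda>k. 1 - c / real (Suc k)"
  \<comment> \<open>The positive part keeps the contraction valid after \<open>V\<close> has dropped
    below \<open>\<delta>\<close>.\<close>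
  define W where "W k = max 0 (V k - \<delta>)" for k
  have p0: "0 \<le> ?p k" for k using c by (auto simp: field_simps)
  have W: "W (Suc k) \<le> ?p k * W k" if "k \<ge> K" for k
  proof -
    have "\<epsilon> k / real (Suc k) \<le> c * \<delta> / real (Suc k)"
      using K[OF that] by (intro divide_right_mono) auto
    moreover have "?p k * (V k - \<delta>) = ?p k * V k + c * \<delta> / real (Suc k) - \<delta>"
      by (simp add: algebra_simps diff_divide_distrib)
    ultimately have "V (Suc k) - \<delta> \<le> ?p k * (V k - \<delta>)"
      using step[of k] by linarith
    also have "\<dots> \<le> ?p k * W k"
      using p0 by (intro mult_left_mono) (auto simp: W_def)
    finally show ?thesis
      using mult_nonneg_nonneg[OF p0[of k], of "W k"] by (auto simp: W_def)
  qed
  define g where "g k = (\<Prod>i\<in>{K..<k}. ?p i)" for k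
  have Wg: "W k \<le> W K * g k" if "k \<ge> K" for k
    using that
  proof (induction k rule: dec_induct)
    case base
    then show ?case by (simp add: g_def)
  next
    case (step k)
    have "W (Suc k) \<le> ?p k * (W K * g k)"
      using W[OF step(1)] mult_left_mono[OF step(3) p0[of k]] by linarith
    also have "\<dots> = W K * g (Suc k)"
      using step(1) by (simp add: g_def)
    finally show ?case .
  qed
  have "g \<longlonglongrightarrow> 0"
  proof -
    \<comment> \<open>The tail product is the full product divided by its first \<open>K\<close>
      factors; \<open>c < 1\<close> keeps the factor at index 0, and with it the divisor,
      nonzero.\<close>
    have nz: "(\<Prod>i<K. ?p i) \<noteq> 0"
      using c by (auto simp: field_simps)
    have eq: "\<forall>\<^sub>F k in sequentially. (\<Prod>i<k. ?p i) / (\<Prod>i<K. ?p i) = g k"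
    proof (rule eventually_sequentiallyI[of K])
      fix k assume "K \<le> k"
      then have "(\<Prod>i<k. ?p i) = (\<Prod>i<K. ?p i) * g k"
        unfolding g_def lessThan_atLeast0 by (intro prod.atLeastLessThan_concat[symmetric]) auto
      then show "(\<Prod>i<k. ?p i) / (\<Prod>i<K. ?p i) = g k"
        using nz by (simp only: nonzero_mult_div_cancel_left not_False_eq_True)
    qed
    have "(\<lambda>k. \<Prod>i<k. ?p i) \<longlonglongrightarrow> 0"
      using prod_one_minus_harmonic_tendsto_0[of c] c by simp
    then show ?thesis
      by (rule Lim_transform_eventually[OF tendsto_divide_zero eq])
  qed
  then have "(\<lambda>k. W K * g k) \<longlonglongrightarrow> 0"
    using tendsto_mult_right_zero by blast
  then have "\<forall>\<^sub>F k in sequentially. W K * g k < \<delta>"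
    using \<delta> order_tendstoD(2) by blast
  then obtain K' where K': "\<And>k. k \<ge> K' \<Longrightarrow> W K * g k < \<delta>"
    by (auto simp: eventually_sequentially)
  show "\<exists>no. \<forall>n\<ge>no. norm (V n - 0) < r"
  proof (intro exI[of _ "max K K'"] allI impI)
    fix n assume "max K K' \<le> n"
    then have "W n < \<delta>" using Wg[of n] K'[of n] by linarith
    then show "norm (V n - 0) < r" using nonneg[of n] r by (simp add: W_def \<delta>_def max_def split: if_splits)
  qed
qed

text \<open>Irreducibility is expressed as reachability along positive entries, so that the
  arguments below are inductions over paths.\<close>

locale irreducible_stochastic =
  fixes S :: "'b set" and P :: "'b \<Rightarrow> 'b \<Rightarrow> real"
  assumes finite: "finite S"
    and nonneg: "a \<in> S \<Longrightarrow> b \<in> S \<Longrightarrow> 0 \<le> P a b"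
    and row_sum: "a \<in> S \<Longrightarrow> (\<Sum>b\<in>S. P a b) = 1"
    and irreducible: "a \<in> S \<Longrightarrow> b \<in> S \<Longrightarrow>
      (a, b) \<in> {(x, y). x \<in> S \<and> y \<in> S \<and> 0 < P x y}\<^sup>*"
begin

definition stationary :: "('b \<Rightarrow> real) \<Rightarrow> bool" where
  "stationary v \<longleftrightarrow> (\<forall>b\<in>S. (\<Sum>a\<in>S. v a * P a b) = v b)"

text \<open>The triangle inequality makes \<open>\<bar>v\<bar> P\<close> at least
  \<open>\<bar>v\<bar>\<close> in every entry, while row sums one make the totals agree; hence
  equality everywhere. This turns a stationary vector of unknown signs into a non-negative
  one.\<close>

lemma stationary_abs:
  assumes v: "stationary v"
  shows "stationary (\<lambda>a. \<bar>v a\<bar>)"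
proof -
  define g where "g b = (\<Sum>a\<in>S. \<bar>v a\<bar> * P a b) - \<bar>v b\<bar>" for b
  have g0: "0 \<le> g b" if "b \<in> S" for b
  proof -
    have "\<bar>v b\<bar> = \<bar>\<Sum>a\<in>S. v a * P a b\<bar>"
      using v that by (simp add: stationary_def)
    also have "\<dots> \<le> (\<Sum>a\<in>S. \<bar>v a * P a b\<bar>)" by (rule sum_abs)
    also have "\<dots> = (\<Sum>a\<in>S. \<bar>v a\<bar> * P a b)"
      using nonneg that by (intro sum.cong) (auto simp: abs_mult)
    finally show ?thesis by (simp add: g_def)
  qed
  have "(\<Sum>b\<in>S. \<Sum>a\<in>S. \<bar>v a\<bar> * P a b) = (\<Sum>a\<in>S. \<bar>v a\<bar>)"
    by (subst sum.swap) (simp add: sum_distrib_left[symmetric] row_sum)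
  then have "(\<Sum>b\<in>S. g b) = 0" by (simp add: g_def sum_subtractf)
  then have "\<forall>b\<in>S. g b = 0"
    using sum_nonneg_eq_0_iff[OF finite, of g] g0 by simp
  then show ?thesis by (simp add: g_def stationary_def)
qed

text \<open>Zeros spread backwards along edges: if \<open>\<bar>v y\<bar> = 0\<close>, all the
  non-negative terms \<open>\<bar>v x\<bar> * P x y\<close> vanish. Both positivity and uniqueness
  of stationary vectors rest on this.\<close>

lemma stationary_eq_0:
  assumes v: "stationary v" and a: "a \<in> S" "v a = 0" and b: "b \<in> S"
  shows "v b = 0"
proof -
  have "(b, a) \<in> {(x, y). x \<in> S \<and> y \<in> S \<and> 0 < P x y}\<^sup>*"
    using irreducible a b by simp
  then have "\<bar>v b\<bar> = 0"
  proof (induction rule: converse_rtrancl_induct)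
    case base
    then show ?case using a by simp
  next
    case (step x y)
    then have xy: "x \<in> S" "y \<in> S" "0 < P x y" by auto
    have "(\<Sum>z\<in>S. \<bar>v z\<bar> * P z y) = 0"
      using stationary_abs[OF v] step xy by (simp add: stationary_def)
    then have "\<bar>v x\<bar> * P x y = 0"
      using sum_nonneg_eq_0_iff[OF finite, of "\<lambda>z. \<bar>v z\<bar> * P z y"] xy nonneg by auto
    then show ?case using xy by simp
  qed
  then show ?thesis by simp
qed

lemma stationary_positive_abs:
  assumes v: "stationary v" and a: "a \<in> S" "v a \<noteq> 0" and b: "b \<in> S"
  shows "0 < \<bar>v b\<bar>"
  using stationary_eq_0[OF v b _ a(1)] a by auto

text \<open>Subtract the multiple of \<open>\<mu>\<close> that cancels \<open>v\<close> at
  \<open>a\<close>: the difference is stationary with a zero, hence zero.\<close>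

lemma stationary_proportional:
  assumes v: "stationary v" and \<mu>: "stationary \<mu>" and a: "a \<in> S" "\<mu> a \<noteq> 0" and b: "b \<in> S"
  shows "v b = v a / \<mu> a * \<mu> b"
proof -
  let ?w = "\<lambda>b. v b - v a / \<mu> a * \<mu> b"
  have "stationary ?w"
    unfolding stationary_def
  proof
    fix b assume b: "b \<in> S"
    have "(\<Sum>x\<in>S. ?w x * P x b) = (\<Sum>x\<in>S. v x * P x b) - v a / \<mu> a * (\<Sum>x\<in>S. \<mu> x * P x b)"
      by (simp only: sum_distrib_left sum_subtractf[symmetric]) (simp add: algebra_simps)
    then show "(\<Sum>x\<in>S. ?w x * P x b) = ?w b"
      using v \<mu> b by (simp add: stationary_def)
  qed
  from stationary_eq_0[OF this a(1) _ b] a show ?thesis by simp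
qed

section \<open>The Dirichlet form and its Poincare inequality\<close>

definition dirichlet :: "('b \<Rightarrow> real) \<Rightarrow> ('b \<Rightarrow> real) \<Rightarrow> real" where
  "dirichlet \<mu> u = (\<Sum>a\<in>S. \<Sum>b\<in>S. \<mu> a * P a b * (u a - u b)\<^sup>2)"

text \<open>When the square is expanded, row sums one evaluate the \<open>u a\<close> part and
  stationarity the \<open>u b\<close> part. The result is twice the inner product of
  \<open>u\<close> with \<open>(1 - P) u\<close>, weighted by \<open>\<mu>\<close>, the expression
  that the drift of the Lyapunov function produces.\<close>

lemma dirichlet_eq:
  assumes \<mu>: "stationary \<mu>"
  shows "dirichlet \<mu> u =
    2 * ((\<Sum>a\<in>S. \<mu> a * (u a)\<^sup>2) - (\<Sum>b\<in>S. u b * (\<Sum>a\<in>S. \<mu> a * u a * P a b)))"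
proof -
  have "dirichlet \<mu> u = (\<Sum>a\<in>S. \<Sum>b\<in>S. (\<mu> a * (u a)\<^sup>2) * P a b)
      + (\<Sum>a\<in>S. \<Sum>b\<in>S. (u b)\<^sup>2 * (\<mu> a * P a b)) - 2 * (\<Sum>a\<in>S. \<Sum>b\<in>S. u b * (\<mu> a * u a * P a b))"
    unfolding dirichlet_def
    by (simp add: sum_distrib_left sum.distrib[symmetric] sum_subtractf[symmetric]
        power2_eq_square algebra_simps)
  also have "(\<Sum>a\<in>S. \<Sum>b\<in>S. (\<mu> a * (u a)\<^sup>2) * P a b) = (\<Sum>a\<in>S. \<mu> a * (u a)\<^sup>2)"
    by (simp add: sum_distrib_left[symmetric] row_sum)
  also have "(\<Sum>a\<in>S. \<Sum>b\<in>S. (u b)\<^sup>2 * (\<mu> a * P a b)) = (\<Sum>a\<in>S. \<mu> a * (u a)\<^sup>2)"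
    by (subst sum.swap, simp only: sum_distrib_left[symmetric])
      (use \<mu> in \<open>simp add: stationary_def mult.commute\<close>)
  also have "(\<Sum>a\<in>S. \<Sum>b\<in>S. u b * (\<mu> a * u a * P a b)) =
      (\<Sum>b\<in>S. u b * (\<Sum>a\<in>S. \<mu> a * u a * P a b))"
    by (subst sum.swap) (simp add: sum_distrib_left)
  finally show ?thesis by simp
qed

lemma dirichlet_nonneg: "(\<And>a. a \<in> S \<Longrightarrow> 0 \<le> \<mu> a) \<Longrightarrow> 0 \<le> dirichlet \<mu> u"
  unfolding dirichlet_def by (intro sum_nonneg mult_nonneg_nonneg nonneg) auto

text \<open>Each edge of a path from \<open>a\<close> to \<open>b\<close> is controlled by a single
  term of the form, with weight \<open>\<mu> y * P y z\<close>. Chaining the edges yields a constant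
  that depends on the path but not on \<open>u\<close>.\<close>

lemma square_diff_le_dirichlet:
  assumes pos: "\<And>a. a \<in> S \<Longrightarrow> 0 < \<mu> a" and "a \<in> S" "b \<in> S"
  shows "\<exists>K\<ge>0. \<forall>u. (u a - u b)\<^sup>2 \<le> K * dirichlet \<mu> u"
proof -
  have "(a, b) \<in> {(x, y). x \<in> S \<and> y \<in> S \<and> 0 < P x y}\<^sup>*"
    using irreducible assms by simp
  then show ?thesis
  proof (induction rule: rtrancl_induct)
    case base
    show ?case by (intro exI[of _ 0]) simp
  next
    case (step y z)
    then obtain K where K: "K \<ge> 0" "\<And>u. (u a - u y)\<^sup>2 \<le> K * dirichlet \<mu> u"
      by blast
    have yz: "y \<in> S" "z \<in> S" "0 < P y z" using step by auto
    define c where "c = \<mu> y * P y z"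
    have c: "0 < c" using yz pos by (simp add: c_def)
    have edge: "c * (u y - u z)\<^sup>2 \<le> dirichlet \<mu> u" for u
    proof -
      have "c * (u y - u z)\<^sup>2 \<le> (\<Sum>b\<in>S. \<mu> y * P y b * (u y - u b)\<^sup>2)"
        unfolding c_def using yz nonneg pos
        by (intro member_le_sum[where f="\<lambda>b. \<mu> y * P y b * (u y - u b)\<^sup>2"] finite)
          (auto intro!: mult_nonneg_nonneg simp: less_imp_le)
      also have "\<dots> \<le> dirichlet \<mu> u"
        unfolding dirichlet_def using yz nonneg pos
        by (intro member_le_sum[where f="\<lambda>a. \<Sum>b\<in>S. \<mu> a * P a b * (u a - u b)\<^sup>2"] finite)
          (auto intro!: sum_nonneg mult_nonneg_nonneg simp: less_imp_le)
      finally show ?thesis .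
    qed
    \<comment> \<open>The new constant comes from \<open>(s + t)^2 \<le> 2 s^2 + 2 t^2\<close>, with
      the induction hypothesis for \<open>s\<close> and the last edge for \<open>t\<close>.\<close>
    have "(u a - u z)\<^sup>2 \<le> (2 * K + 2 / c) * dirichlet \<mu> u" for u
    proof -
      have "(u a - u z)\<^sup>2 \<le> 2 * (u a - u y)\<^sup>2 + 2 * (u y - u z)\<^sup>2"
        using zero_le_power2[of "(u a - u y) - (u y - u z)"]
        by (simp add: power2_eq_square algebra_simps)
      moreover have "(u y - u z)\<^sup>2 \<le> dirichlet \<mu> u / c"
        using edge[of u] c by (simp add: pos_le_divide_eq mult.commute)
      ultimately show ?thesis
        using K(2)[of u] by (simp add: algebra_simps)
    qed
    then show ?case
      using K c by (intro exI[of _ "2 * K + 2 / c"]) auto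
  qed
qed

text \<open>For centred \<open>u\<close>, the weighted sum of squares is a weighted double sum of
  \<open>(u a - u b)^2\<close>, since the cross term is the square of the mean. Each of these
  differences is bounded by the Dirichlet form.\<close>

lemma poincare:
  assumes pos: "\<And>a. a \<in> S \<Longrightarrow> 0 < \<mu> a"
  shows "\<exists>K\<ge>0. \<forall>u. (\<Sum>a\<in>S. \<mu> a * u a) = 0 \<longrightarrow> (\<Sum>a\<in>S. \<mu> a * (u a)\<^sup>2) \<le> K * dirichlet \<mu> u"
proof (cases "S = {}")
  case True
  then show ?thesis by (intro exI[of _ 0]) simp
next
  case False
  have "\<forall>x\<in>S \<times> S. \<exists>K\<ge>0. \<forall>u. (u (fst x) - u (snd x))\<^sup>2 \<le> K * dirichlet \<mu> u"
    using square_diff_le_dirichlet[OF pos] by auto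
  then obtain k where k: "\<And>a b. a \<in> S \<Longrightarrow> b \<in> S \<Longrightarrow> 0 \<le> k (a, b)"
    "\<And>a b u. a \<in> S \<Longrightarrow> b \<in> S \<Longrightarrow> (u a - u b)\<^sup>2 \<le> k (a, b) * dirichlet \<mu> u"
    unfolding bchoice_iff by fastforce
  define s where "s = (\<Sum>a\<in>S. \<mu> a)"
  have s: "0 < s" unfolding s_def using False finite pos by (intro sum_pos) auto
  \<comment> \<open>The weighted sum of the pair constants; the divisor \<open>2 * s\<close> comes
    from the double sum identity, as \<open>\<mu>\<close> is not assumed to have total mass
    one.\<close>
  define K where "K = (\<Sum>a\<in>S. \<Sum>b\<in>S. \<mu> a * \<mu> b * k (a, b)) / (2 * s)"
  have "0 \<le> K" unfolding K_def using k pos s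
    by (intro divide_nonneg_nonneg sum_nonneg mult_nonneg_nonneg) (auto simp: less_imp_le)
  moreover have "(\<Sum>a\<in>S. \<mu> a * (u a)\<^sup>2) \<le> K * dirichlet \<mu> u"
    if u: "(\<Sum>a\<in>S. \<mu> a * u a) = 0" for u
  proof -
    have "2 * s * (\<Sum>a\<in>S. \<mu> a * (u a)\<^sup>2) =
      (\<Sum>a\<in>S. \<mu> a * (u a)\<^sup>2) * (\<Sum>b\<in>S. \<mu> b) + (\<Sum>a\<in>S. \<mu> a) * (\<Sum>b\<in>S. \<mu> b * (u b)\<^sup>2)
        - 2 * ((\<Sum>a\<in>S. \<mu> a * u a) * (\<Sum>b\<in>S. \<mu> b * u b))"
      unfolding u s_def by simp
    also have "\<dots> = (\<Sum>a\<in>S. \<Sum>b\<in>S. \<mu> a * \<mu> b * (u a - u b)\<^sup>2)"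
      unfolding sum_product
      by (simp add: sum_distrib_left sum.distrib[symmetric] sum_subtractf[symmetric]
        power2_eq_square algebra_simps)
    also have "\<dots> \<le> (\<Sum>a\<in>S. \<Sum>b\<in>S. \<mu> a * \<mu> b * (k (a, b) * dirichlet \<mu> u))"
      using k(2) pos by (intro sum_mono mult_left_mono) (auto simp: less_imp_le)
    also have "\<dots> = 2 * s * (K * dirichlet \<mu> u)"
      using s by (simp add: K_def sum_distrib_right mult.assoc)
    finally show ?thesis using s by simp
  qed
  ultimately show ?thesis by blast
qed

text \<open>The weighted square distance to \<open>\<mu>\<close> is a Lyapunov function: the drift of the averages
  changes it by minus the Dirichlet form, which dominates it by the Poincare inequality.\<close>

theorem averages_tendsto_stationary:
  fixes x z :: "nat \<Rightarrow> 'b \<Rightarrow> real"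
  assumes \<mu>: "stationary \<mu>" and pos: "\<And>a. a \<in> S \<Longrightarrow> 0 < \<mu> a"
    and z_bounds: "\<And>k a. a \<in> S \<Longrightarrow> z k a \<in> {0..1}"
    and x_bounds: "\<And>k a. a \<in> S \<Longrightarrow> x k a \<in> {0..1}"
    and mass: "\<And>k. (\<Sum>a\<in>S. z k a) = (\<Sum>a\<in>S. \<mu> a)"
    and average: "\<And>k a. a \<in> S \<Longrightarrow> z (Suc k) a = z k a + (x (Suc k) a - z k a) / real (k + 2)"
    and error: "\<And>b. b \<in> S \<Longrightarrow> (\<lambda>k. x (Suc k) b - (\<Sum>a\<in>S. z k a * P a b)) \<longlonglongrightarrow> 0"
    and a: "a \<in> S"
  shows "(\<lambda>k. z k a) \<longlonglongrightarrow> \<mu> a"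
proof -
  define w where "w k a = z k a - \<mu> a" for k a
  \<comment> \<open>The density of the deviation relative to \<open>\<mu>\<close>. It is centred
    because \<open>z k\<close> and \<open>\<mu>\<close> have equal mass, which is what the Poincare
    inequality requires.\<close>
  define u where "u k a = w k a / \<mu> a" for k a
  define e where "e k b = x (Suc k) b - (\<Sum>a\<in>S. z k a * P a b)" for k b
  define V where "V k = (\<Sum>a\<in>S. (w k a)\<^sup>2 / \<mu> a)" for k
  obtain K0 where K0: "K0 \<ge> 0" "\<And>u. (\<Sum>a\<in>S. \<mu> a * u a) = 0 \<Longrightarrow>
      (\<Sum>a\<in>S. \<mu> a * (u a)\<^sup>2) \<le> K0 * dirichlet \<mu> u"
    using poincare[of \<mu>] pos by blast
  \<comment> \<open>Adding 1 ensures \<open>K \<ge> 1\<close>, so that the contraction rate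
    \<open>1 / (2 * K)\<close> used below is strictly less than 1.\<close>
  define K where "K = K0 + 1"
  have K: "K \<ge> 1" using K0 by (simp add: K_def)
  have D0: "0 \<le> dirichlet \<mu> f" for f using pos by (intro dirichlet_nonneg) (simp add: less_imp_le)
  have wu: "w k a = \<mu> a * u k a" if "a \<in> S" for k a
    using pos[OF that] by (simp add: u_def)
  have V_eq: "V k = (\<Sum>a\<in>S. \<mu> a * (u k a)\<^sup>2)" for k
    unfolding V_def using pos by (intro sum.cong) (auto simp: u_def power2_eq_square)
  have V_le: "V k \<le> K * dirichlet \<mu> (u k)" for k
  proof -
    have "(\<Sum>a\<in>S. \<mu> a * u k a) = (\<Sum>a\<in>S. w k a)"
      using wu by (intro sum.cong) auto
    also have "\<dots> = 0" using mass by (simp add: w_def sum_subtractf)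
    finally have "V k \<le> K0 * dirichlet \<mu> (u k)" using K0(2) V_eq by simp
    then show ?thesis using D0[of "u k"] by (simp add: K_def algebra_simps)
  qed
  \<comment> \<open>The part of the increment of \<open>V\<close> not due to the drift: the
    recursion error tested against \<open>u\<close>, and the second-order term of the
    square.\<close>
  define \<epsilon> where "\<epsilon> k = 2 * (\<Sum>b\<in>S. u k b * e k b)
      + (\<Sum>b\<in>S. (x (Suc k) b - z k b)\<^sup>2 / \<mu> b) / real (k + 2)" for k
  have step: "V (Suc k) = V k - dirichlet \<mu> (u k) / real (k + 2) + \<epsilon> k / real (k + 2)" for k
  proof -
    define h where "h = 1 / real (k + 2)"
    have drift: "x (Suc k) b - z k b = (\<Sum>a\<in>S. w k a * P a b) - w k b + e k b" if "b \<in> S" for b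
    proof -
      have "(\<Sum>a\<in>S. z k a * P a b) = (\<Sum>a\<in>S. w k a * P a b) + \<mu> b"
        using \<mu> that unfolding stationary_def w_def
        by (simp add: left_diff_distrib sum_subtractf)
      then show ?thesis by (simp add: e_def w_def)
    qed
    have "V (Suc k) = (\<Sum>b\<in>S. (w k b)\<^sup>2 / \<mu> b + 2 * h * (u k b * (x (Suc k) b - z k b))
        + h * ((x (Suc k) b - z k b)\<^sup>2 / \<mu> b * h))"
      unfolding V_def
    proof (rule sum.cong[OF refl])
      fix b assume b: "b \<in> S"
      have w: "w (Suc k) b = w k b + h * (x (Suc k) b - z k b)"
        using average[OF b, of k] by (simp add: w_def h_def)
      show "(w (Suc k) b)\<^sup>2 / \<mu> b = (w k b)\<^sup>2 / \<mu> b + 2 * h * (u k b * (x (Suc k) b - z k b))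
        + h * ((x (Suc k) b - z k b)\<^sup>2 / \<mu> b * h)"
        unfolding w using pos[OF b] by (simp add: u_def field_simps power2_eq_square)
    qed
    also have "\<dots> = V k + 2 * h * (\<Sum>b\<in>S. u k b * (x (Suc k) b - z k b))
        + h * ((\<Sum>b\<in>S. (x (Suc k) b - z k b)\<^sup>2 / \<mu> b) * h)"
      by (simp add: V_def sum.distrib sum_distrib_left sum_distrib_right)
    also have "(\<Sum>b\<in>S. u k b * (x (Suc k) b - z k b)) =
        (\<Sum>b\<in>S. u k b * (\<Sum>a\<in>S. \<mu> a * u k a * P a b) - \<mu> b * (u k b)\<^sup>2 + u k b * e k b)"
    proof (rule sum.cong[OF refl])
      fix b assume b: "b \<in> S"
      have "(\<Sum>a\<in>S. w k a * P a b) = (\<Sum>a\<in>S. \<mu> a * u k a * P a b)"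
        by (intro sum.cong) (auto simp: wu)
      then show "u k b * (x (Suc k) b - z k b) =
          u k b * (\<Sum>a\<in>S. \<mu> a * u k a * P a b) - \<mu> b * (u k b)\<^sup>2 + u k b * e k b"
        unfolding drift[OF b] wu[OF b] by (simp add: algebra_simps power2_eq_square)
    qed
    also have "\<dots> = - dirichlet \<mu> (u k) / 2 + (\<Sum>b\<in>S. u k b * e k b)"
      unfolding dirichlet_eq[OF \<mu>] by (simp add: sum.distrib sum_subtractf)
    finally have "V (Suc k) = V k - dirichlet \<mu> (u k) * h + (2 * (\<Sum>b\<in>S. u k b * e k b)
        + (\<Sum>b\<in>S. (x (Suc k) b - z k b)\<^sup>2 / \<mu> b) * h) * h"
      by (simp add: algebra_simps)
    then show ?thesis by (simp add: \<epsilon>_def h_def)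
  qed
  have "\<epsilon> \<longlonglongrightarrow> 0"
  proof -
    have 1: "(\<lambda>k. u k b * e k b) \<longlonglongrightarrow> 0" if b: "b \<in> S" for b
    proof (rule Lim_null_comparison)
      have "\<bar>u k b\<bar> \<le> (1 + \<mu> b) / \<mu> b" for k
        using pos[OF b] z_bounds[OF b, of k] by (auto simp: u_def w_def divide_simps abs_le_iff)
      then have "norm (u k b * e k b) \<le> (1 + \<mu> b) / \<mu> b * \<bar>e k b\<bar>" for k
        unfolding real_norm_def abs_mult by (rule mult_right_mono) simp
      then show "\<forall>\<^sub>F k in sequentially. norm (u k b * e k b) \<le> (1 + \<mu> b) / \<mu> b * \<bar>e k b\<bar>"
        by simp
      show "(\<lambda>k. (1 + \<mu> b) / \<mu> b * \<bar>e k b\<bar>) \<longlonglongrightarrow> 0"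
        using error[OF b] unfolding e_def by (intro tendsto_mult_right_zero tendsto_rabs_zero)
    qed
    have 2: "(\<lambda>k. ((x (Suc k) b - z k b)\<^sup>2 / \<mu> b) / real (k + 2)) \<longlonglongrightarrow> 0" if b: "b \<in> S" for b
    proof (rule Lim_null_comparison)
      have "\<bar>x (Suc k) b - z k b\<bar> \<le> 1" for k
        using x_bounds[OF b, of "Suc k"] z_bounds[OF b, of k] by auto
      then have "(x (Suc k) b - z k b)\<^sup>2 \<le> 1" for k
        by (simp add: abs_square_le_1)
      then have "(x (Suc k) b - z k b)\<^sup>2 / \<mu> b / real (k + 2) \<le> (1 / \<mu> b) / real (k + 2)" for k
        using pos[OF b] by (intro divide_right_mono) auto
      then show "\<forall>\<^sub>F k in sequentially.
          norm ((x (Suc k) b - z k b)\<^sup>2 / \<mu> b / real (k + 2)) \<le> (1 / \<mu> b) / real (k + 2)"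
        using pos[OF b] by simp
      show "(\<lambda>k. (1 / \<mu> b) / real (k + 2)) \<longlonglongrightarrow> 0"
        by (rule LIMSEQ_ignore_initial_segment[OF lim_const_over_n])
    qed
    have "(\<lambda>k. 2 * (\<Sum>b\<in>S. u k b * e k b)
        + (\<Sum>b\<in>S. (x (Suc k) b - z k b)\<^sup>2 / \<mu> b / real (k + 2))) \<longlonglongrightarrow> 2 * (\<Sum>b\<in>S. 0) + (\<Sum>b\<in>S. 0)"
      by (intro tendsto_add tendsto_mult tendsto_const tendsto_sum 1 2)
    then show ?thesis by (simp add: \<epsilon>_def[abs_def] sum_divide_distrib)
  qed
  moreover have "V (Suc k) \<le> (1 - 1 / (2 * K) / real (Suc k)) * V k + \<bar>\<epsilon> k\<bar> / real (Suc k)" for k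
  proof -
    have V0: "0 \<le> V k" for k unfolding V_def using pos by (intro sum_nonneg) (auto simp: less_imp_le)
    \<comment> \<open>The recursion has denominator \<open>k + 2\<close>, the convergence criterion
      \<open>k + 1\<close>; the bound \<open>k + 2 \<le> 2 * (k + 1)\<close> costs the factor 2 in
      the rate.\<close>
    have "V k / (2 * K) / real (Suc k) = V k / K / real (2 * Suc k)" by simp
    also have "\<dots> \<le> V k / K / real (k + 2)"
      using V0[of k] K by (intro divide_left_mono divide_nonneg_nonneg) auto
    also have "\<dots> \<le> dirichlet \<mu> (u k) / real (k + 2)"
      using V_le[of k] K by (intro divide_right_mono) (simp_all add: pos_divide_le_eq mult.commute)
    finally have "V k / (2 * K) / real (Suc k) \<le> dirichlet \<mu> (u k) / real (k + 2)" .
    moreover have "\<epsilon> k / real (k + 2) \<le> \<bar>\<epsilon> k\<bar> / real (k + 2)"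
      by (intro divide_right_mono) auto
    moreover have "\<bar>\<epsilon> k\<bar> / real (k + 2) \<le> \<bar>\<epsilon> k\<bar> / real (Suc k)"
      by (intro divide_left_mono) auto
    ultimately show ?thesis using step[of k] by (simp add: algebra_simps)
  qed
  ultimately have "V \<longlonglongrightarrow> 0"
    using pos K
    by (intro harmonic_recursion_tendsto_0[of V "1 / (2 * K)" "\<lambda>k. \<bar>\<epsilon> k\<bar>"] tendsto_rabs_zero)
      (auto simp: V_def less_imp_le intro!: sum_nonneg)
  then have "(\<lambda>k. \<mu> a * V k) \<longlonglongrightarrow> 0" by (rule tendsto_mult_right_zero)
  then have "(\<lambda>k. (w k a)\<^sup>2) \<longlonglongrightarrow> 0"
  proof (rule Lim_null_comparison[rotated])
    have "(w k a)\<^sup>2 / \<mu> a \<le> V k" for k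
      unfolding V_def using a pos finite
      by (intro member_le_sum[where f="\<lambda>a. (w k a)\<^sup>2 / \<mu> a"]) (auto simp: less_imp_le)
    then show "\<forall>\<^sub>F k in sequentially. norm ((w k a)\<^sup>2) \<le> \<mu> a * V k"
      using pos[OF a] by (simp add: field_simps)
  qed
  then have "(\<lambda>k. w k a) \<longlonglongrightarrow> 0"
    using tendsto_real_sqrt[of "\<lambda>k. (w k a)\<^sup>2"] by (simp add: tendsto_rabs_zero_iff)
  then show ?thesis unfolding w_def by (simp add: LIM_zero_iff)
qed

end

section \<open>A strong law of large numbers\<close>

text \<open>With \<open>q\<close> the integer square root of \<open>n\<close>, at most
  \<open>2 * q\<close> terms lie beyond \<open>q^2\<close>, each of size at most one. They change
  the average by at most \<open>2 / q\<close>.\<close>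

lemma average_tendsto_0_if_square_subsequence:
  fixes f :: "nat \<Rightarrow> real"
  assumes bound: "\<And>n. \<bar>f n\<bar> \<le> 1"
    and sub: "(\<lambda>n. (\<Sum>i<n\<^sup>2. f i) / real (n\<^sup>2)) \<longlonglongrightarrow> 0"
  shows "(\<lambda>n. (\<Sum>i<n. f i) / real n) \<longlonglongrightarrow> 0"
proof (rule Lim_null_comparison)
  define q where "q = floor_sqrt"
  let ?g = "\<lambda>k. \<bar>(\<Sum>i<k\<^sup>2. f i) / real (k\<^sup>2)\<bar> + 2 / real k"
  have le: "norm ((\<Sum>i<n. f i) / real n) \<le> ?g (q n)" if n: "n \<ge> 1" for n
  proof -
    have q1: "q n \<ge> 1" "(q n)\<^sup>2 \<le> n" "n < (Suc (q n))\<^sup>2"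
      using n unfolding q_def by (auto simp: Suc_floor_sqrt_power2_gt le_floor_sqrt_iff)
    then have le: "n - (q n)\<^sup>2 \<le> 2 * q n" by (simp add: power2_eq_square)
    have "(\<Sum>i<n. f i) = (\<Sum>i<(q n)\<^sup>2. f i) + (\<Sum>i=(q n)\<^sup>2..<n. f i)"
      unfolding lessThan_atLeast0 using q1 by (intro sum.atLeastLessThan_concat[symmetric]) auto
    moreover have "\<bar>\<Sum>i=(q n)\<^sup>2..<n. f i\<bar> \<le> 2 * real (q n)"
    proof -
      have "\<bar>\<Sum>i=(q n)\<^sup>2..<n. f i\<bar> \<le> (\<Sum>i=(q n)\<^sup>2..<n. 1)"
        by (rule order.trans[OF sum_abs sum_mono[OF bound]])
      also have "\<dots> = real (n - (q n)\<^sup>2)" by simp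
      also have "\<dots> \<le> real (2 * q n)" using le by (simp only: of_nat_le_iff)
      finally show ?thesis by simp
    qed
    ultimately have "\<bar>\<Sum>i<n. f i\<bar> \<le> \<bar>\<Sum>i<(q n)\<^sup>2. f i\<bar> + 2 * real (q n)" by linarith
    then have "\<bar>\<Sum>i<n. f i\<bar> / real n \<le> (\<bar>\<Sum>i<(q n)\<^sup>2. f i\<bar> + 2 * real (q n)) / real n"
      by (rule divide_right_mono) simp
    also have "\<dots> \<le> (\<bar>\<Sum>i<(q n)\<^sup>2. f i\<bar> + 2 * real (q n)) / real ((q n)\<^sup>2)"
      using q1 n by (intro divide_left_mono) (auto simp del: of_nat_power)
    also have "\<dots> = ?g (q n)"
      using q1 by (simp add: field_simps power2_eq_square)
    finally show ?thesis by simp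
  qed
  show "\<forall>\<^sub>F n in sequentially. norm ((\<Sum>i<n. f i) / real n) \<le> ?g (q n)"
    using le by (auto simp: eventually_sequentially)
  have "?g \<longlonglongrightarrow> 0 + 0"
    by (intro tendsto_add tendsto_rabs_zero sub lim_const_over_n)
  moreover have "filterlim q at_top sequentially"
    unfolding filterlim_at_top
  proof
    fix Z
    show "\<forall>\<^sub>F n in sequentially. Z \<le> q n"
      by (rule eventually_sequentiallyI[of "Z\<^sup>2"]) (simp add: q_def le_floor_sqrt_iff)
  qed
  ultimately show "(\<lambda>n. ?g (q n)) \<longlonglongrightarrow> 0"
    using filterlim_compose by fastforce
qed

context prob_space
begin

lemma uncorrelated_sum_square:
  fixes X :: "nat \<Rightarrow> 'a \<Rightarrow> real"
  assumes [measurable]: "\<And>n. random_variable borel (X n)"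
    and bound: "\<And>n. AE \<omega> in M. \<bar>X n \<omega>\<bar> \<le> 1"
    and uncorrelated: "\<And>i j. i < j \<Longrightarrow> expectation (\<lambda>\<omega>. X i \<omega> * X j \<omega>) = 0"
  shows "expectation (\<lambda>\<omega>. (\<Sum>i<n. X i \<omega>)\<^sup>2) \<le> real n"
    and "integrable M (\<lambda>\<omega>. (\<Sum>i<n. X i \<omega>)\<^sup>2)"
proof -
  have prod_bound: "AE \<omega> in M. norm (X i \<omega> * X j \<omega>) \<le> 1" for i j
    using bound[of i] bound[of j] by eventually_elim (auto simp: abs_mult intro: mult_le_one)
  have int: "integrable M (\<lambda>\<omega>. X i \<omega> * X j \<omega>)" for i j
    by (rule integrable_const_bound[OF prod_bound]) simp
  have sq: "(\<Sum>i<n. X i \<omega>)\<^sup>2 = (\<Sum>i<n. \<Sum>j<n. X i \<omega> * X j \<omega>)" for \<omega>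
    by (simp add: power2_eq_square sum_product)
  show "integrable M (\<lambda>\<omega>. (\<Sum>i<n. X i \<omega>)\<^sup>2)" unfolding sq by (intro Bochner_Integration.integrable_sum int)
  have "expectation (\<lambda>\<omega>. (\<Sum>i<n. X i \<omega>)\<^sup>2) = (\<Sum>i<n. \<Sum>j<n. expectation (\<lambda>\<omega>. X i \<omega> * X j \<omega>))"
    unfolding sq by (simp add: int)
  also have "\<dots> \<le> (\<Sum>i<n. \<Sum>j<n. if i = j then 1 else 0)"
  proof (intro sum_mono)
    fix i j :: nat
    consider "i = j" | "i < j" | "j < i" by linarith
    then show "expectation (\<lambda>\<omega>. X i \<omega> * X j \<omega>) \<le> (if i = j then 1 else 0)"
    proof cases
      case 1
      have "expectation (\<lambda>\<omega>. X i \<omega> * X j \<omega>) \<le> expectation (\<lambda>\<omega>. 1)"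
        by (rule integral_mono_AE[OF int]) (use prod_bound[of i j] in \<open>auto elim: eventually_mono\<close>)
      then show ?thesis using 1 by (simp add: prob_space)
    next
      case 2
      then show ?thesis using uncorrelated by simp
    next
      case 3
      then show ?thesis using uncorrelated[of j i] by (simp add: mult.commute)
    qed
  qed
  also have "\<dots> = real n" by simp
  finally show "expectation (\<lambda>\<omega>. (\<Sum>i<n. X i \<omega>)\<^sup>2) \<le> real n" .
qed

text \<open>Orthogonality bounds the second moment of the average of \<open>n^2\<close> terms by
  \<open>1 / n^2\<close>. This is summable, so the squared averages along squares are almost surely
  summable and tend to 0; boundedness fills the gaps.\<close>

theorem strong_law_bounded_uncorrelated:
  fixes X :: "nat \<Rightarrow> 'a \<Rightarrow> real"
  assumes rv [measurable]: "\<And>n. random_variable borel (X n)"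
    and bound: "\<And>n. AE \<omega> in M. \<bar>X n \<omega>\<bar> \<le> 1"
    and uncorrelated: "\<And>i j. i < j \<Longrightarrow> expectation (\<lambda>\<omega>. X i \<omega> * X j \<omega>) = 0"
  shows "AE \<omega> in M. (\<lambda>n. (\<Sum>i<n. X i \<omega>) / real n) \<longlonglongrightarrow> 0"
proof -
  define Y where "Y n \<omega> = ((\<Sum>i<n\<^sup>2. X i \<omega>) / real (n\<^sup>2))\<^sup>2" for n \<omega>
  have Y [measurable]: "random_variable borel (Y n)" for n unfolding Y_def by simp
  \<comment> \<open>At \<open>n = 0\<close> both sides are 0, division by zero being 0.\<close>
  have le: "(\<integral>\<^sup>+\<omega>. ennreal (Y n \<omega>) \<partial>M) \<le> ennreal (1 / real n ^ 2)" for n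
  proof -
    have eq: "Y n \<omega> = (\<Sum>i<n\<^sup>2. X i \<omega>)\<^sup>2 / (real (n\<^sup>2))\<^sup>2" for \<omega>
      by (simp add: Y_def power_divide)
    have "expectation (Y n) = expectation (\<lambda>\<omega>. (\<Sum>i<n\<^sup>2. X i \<omega>)\<^sup>2) / (real (n\<^sup>2))\<^sup>2"
      unfolding eq by simp
    also have "\<dots> \<le> real (n\<^sup>2) / (real (n\<^sup>2))\<^sup>2"
      by (intro divide_right_mono uncorrelated_sum_square(1) assms) auto
    also have "\<dots> = 1 / real n ^ 2" by (simp add: power2_eq_square)
    finally have "expectation (Y n) \<le> 1 / real n ^ 2" .
    moreover have "integrable M (Y n)"
      unfolding eq by (intro integrable_divide uncorrelated_sum_square(2) assms)
    ultimately show ?thesis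
      by (subst nn_integral_eq_integral) (auto simp: Y_def ennreal_leI)
  qed
  have "(\<integral>\<^sup>+\<omega>. (\<Sum>n. ennreal (Y n \<omega>)) \<partial>M) = (\<Sum>n. \<integral>\<^sup>+\<omega>. ennreal (Y n \<omega>) \<partial>M)"
    by (rule nn_integral_suminf) simp
  also have "\<dots> \<le> (\<Sum>n. ennreal (1 / real n ^ 2))"
    by (intro suminf_le le) auto
  also have "\<dots> = ennreal (\<Sum>n. 1 / real n ^ 2)"
    using inverse_power_summable[of 2, where 'a=real]
    by (intro suminf_ennreal2) (auto simp: divide_inverse)
  also have "\<dots> < \<infinity>" by simp
  finally have "(\<integral>\<^sup>+\<omega>. (\<Sum>n. ennreal (Y n \<omega>)) \<partial>M) \<noteq> \<infinity>" by simp
  then have "AE \<omega> in M. (\<Sum>n. ennreal (Y n \<omega>)) \<noteq> \<infinity>"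
    by (intro nn_integral_PInf_AE) auto
  moreover have "AE \<omega> in M. \<forall>n. \<bar>X n \<omega>\<bar> \<le> 1"
    using bound by (simp add: AE_all_countable)
  ultimately show ?thesis
  proof eventually_elim
    case (elim \<omega>)
    have "summable (\<lambda>n. Y n \<omega>)"
      by (rule summable_suminf_not_top) (use elim(1) in \<open>auto simp: Y_def\<close>)
    then have "(\<lambda>n. Y n \<omega>) \<longlonglongrightarrow> 0" by (rule summable_LIMSEQ_zero)
    then have "(\<lambda>n. (\<Sum>i<n\<^sup>2. X i \<omega>) / real (n\<^sup>2)) \<longlonglongrightarrow> 0"
      unfolding Y_def using tendsto_real_sqrt by (fastforce simp: tendsto_rabs_zero_iff simp del: of_nat_power)
    with elim(2) show ?case by (intro average_tendsto_0_if_square_subsequence) auto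
  qed
qed

end

section \<open>Cyclic products and the block kernel\<close>

text \<open>A positive entry of \<open>B^k * B\<close> has a positive summand, which supplies the
  last edge of the path. This links the matrix notion of irreducibility to reachability.\<close>

lemma pow_mat_pos_imp_path:
  fixes B :: "real mat"
  assumes B: "B \<in> carrier_mat n n"
    and nonneg: "\<And>a b. a < n \<Longrightarrow> b < n \<Longrightarrow> 0 \<le> B $$ (a, b)"
    and "a < n" "b < n" "0 < (B ^\<^sub>m k) $$ (a, b)"
  shows "(a, b) \<in> {(x, y). x < n \<and> y < n \<and> 0 < B $$ (x, y)}\<^sup>*"
  using assms(4,5)
proof (induction k arbitrary: b)
  case 0
  then show ?case using B \<open>a < n\<close> by (auto split: if_splits)
next
  case (Suc k)
  have "(B ^\<^sub>m Suc k) $$ (a, b) = (\<Sum>c<n. (B ^\<^sub>m k) $$ (a, c) * B $$ (c, b))"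
    using B \<open>a < n\<close> Suc.prems by (simp add: scalar_prod_def lessThan_atLeast0 pow_mat_dim_square)
  then have "\<not> (\<Sum>c<n. (B ^\<^sub>m k) $$ (a, c) * B $$ (c, b)) \<le> 0" using Suc.prems(2) by simp
  then obtain c where c: "c < n" "0 < (B ^\<^sub>m k) $$ (a, c) * B $$ (c, b)"
    using sum_nonpos[of "{..<n}" "\<lambda>c. (B ^\<^sub>m k) $$ (a, c) * B $$ (c, b)"] by force
  then have "0 < (B ^\<^sub>m k) $$ (a, c)" "0 < B $$ (c, b)"
    using nonneg[OF c(1) Suc.prems(1)] by (auto simp: zero_less_mult_iff)
  then show ?case
    using Suc.IH[OF c(1)] c(1) Suc.prems(1) by (auto intro: rtrancl_into_rtrancl)
qed

text \<open>This is \<open>cyclic_block_mat\<close> indexed by pairs (urn, colour) in place of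
  numbers below \<open>N * m\<close>, so that sums split by urn without \<open>div\<close> and
  \<open>mod\<close>.\<close>

definition urn_kernel :: "nat \<Rightarrow> (nat \<Rightarrow> real mat) \<Rightarrow> nat \<times> nat \<Rightarrow> nat \<times> nat \<Rightarrow> real" where
  "urn_kernel m R x y =
    (if fst y = next_urn m (fst x) then R (fst y) $$ (snd x, snd y) else 0)"

lemma next_urn_in: "r \<in> {1..m} \<Longrightarrow> next_urn m r \<in> {1..m}"
  by (auto simp: next_urn_def)

lemma next_urn_eq_iff:
  "r \<in> {1..m} \<Longrightarrow> s \<in> {1..m} \<Longrightarrow> next_urn m r = next_urn m s \<longleftrightarrow> r = s"
  by (auto simp: next_urn_def)

lemma next_urn_surj:
  assumes "i \<in> {1..m}"
  obtains r where "r \<in> {1..m}" "i = next_urn m r"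
proof (cases "i = 1")
  case True
  then show thesis using that[of m] assms by (auto simp: next_urn_def)
next
  case False
  then have "i - 1 \<in> {1..m}" "i = next_urn m (i - 1)" using assms by (auto simp: next_urn_def)
  then show thesis by (rule that)
qed

lemma sum_urn_kernel_right:
  assumes r: "r \<in> {1..m}"
  shows "(\<Sum>x\<in>{1..m} \<times> {..<N}. f x * urn_kernel m R x (next_urn m r, b)) =
    (\<Sum>j<N. f (r, j) * R (next_urn m r) $$ (j, b))"
proof -
  have "(\<Sum>x\<in>{1..m} \<times> {..<N}. f x * urn_kernel m R x (next_urn m r, b)) =
      (\<Sum>s\<in>{1..m}. \<Sum>j<N. f (s, j) * urn_kernel m R (s, j) (next_urn m r, b))"
    by (simp add: sum.cartesian_product case_prod_beta)
  also have "\<dots> = (\<Sum>s\<in>{1..m}. if s = r then \<Sum>j<N. f (r, j) * R (next_urn m r) $$ (j, b) else 0)"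
    using r next_urn_eq_iff[OF r] by (intro sum.cong) (auto simp: urn_kernel_def)
  finally show ?thesis using r by simp
qed

lemma sum_urn_kernel_left:
  assumes r: "r \<in> {1..m}"
  shows "(\<Sum>y\<in>{1..m} \<times> {..<N}. urn_kernel m R (r, a) y) =
    (\<Sum>b<N. R (next_urn m r) $$ (a, b))"
proof -
  have "(\<Sum>y\<in>{1..m} \<times> {..<N}. urn_kernel m R (r, a) y) =
      (\<Sum>s\<in>{1..m}. \<Sum>b<N. urn_kernel m R (r, a) (s, b))"
    by (simp add: sum.cartesian_product case_prod_beta)
  also have "\<dots> = (\<Sum>s\<in>{1..m}. if s = next_urn m r
      then \<Sum>b<N. R (next_urn m r) $$ (a, b) else 0)"
    by (intro sum.cong) (auto simp: urn_kernel_def)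
  finally show ?thesis using next_urn_in[OF r] by simp
qed

lemma foldr_mat_mult_carrier:
  assumes "\<And>k. k \<in> set ks \<Longrightarrow> R k \<in> carrier_mat N N"
  shows "foldr (\<lambda>k A. R k * A) ks (1\<^sub>m N) \<in> carrier_mat N N"
  using assms by (induction ks) (auto intro!: mult_carrier_mat)

text \<open>As a row vector, \<open>v\<close> meets the factors of the product from left to right;
  hence \<open>foldl\<close> over the same list.\<close>

lemma transpose_foldr_mat_mult:
  fixes R :: "nat \<Rightarrow> real mat"
  assumes "\<And>k. k \<in> set ks \<Longrightarrow> R k \<in> carrier_mat N N" and "v \<in> carrier_vec N"
  shows "transpose_mat (foldr (\<lambda>k A. R k * A) ks (1\<^sub>m N)) *\<^sub>v v =
    foldl (\<lambda>w k. transpose_mat (R k) *\<^sub>v w) v ks"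
  using assms
proof (induction ks arbitrary: v)
  case Nil
  then show ?case by simp
next
  case (Cons k ks)
  let ?A = "foldr (\<lambda>k A. R k * A) ks (1\<^sub>m N)"
  have A: "?A \<in> carrier_mat N N" using Cons.prems by (intro foldr_mat_mult_carrier) simp
  have k: "R k \<in> carrier_mat N N" using Cons.prems by simp
  have kv: "transpose_mat (R k) *\<^sub>v v \<in> carrier_vec N"
    using k Cons.prems(2) by (intro mult_mat_vec_carrier[of _ N N]) auto
  have "transpose_mat (R k * ?A) *\<^sub>v v = transpose_mat ?A *\<^sub>v (transpose_mat (R k) *\<^sub>v v)"
    using A k Cons.prems(2)
    by (subst transpose_mult[OF k A], subst assoc_mult_mat_vec[of _ N N _ N]) auto
  also have "\<dots> = foldl (\<lambda>w k. transpose_mat (R k) *\<^sub>v w) (transpose_mat (R k) *\<^sub>v v) ks"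
    using Cons.prems kv by (intro Cons.IH) auto
  finally show ?case by simp
qed

locale cyclic_replacement =
  fixes m N :: nat and R :: "nat \<Rightarrow> real mat"
  assumes m: "m \<ge> 1" and N: "N \<ge> 1"
    and carrier: "i \<in> {1..m} \<Longrightarrow> R i \<in> carrier_mat N N"
    and nonneg: "i \<in> {1..m} \<Longrightarrow> a < N \<Longrightarrow> b < N \<Longrightarrow> R i $$ (a, b) \<ge> 0"
    and row_sum: "i \<in> {1..m} \<Longrightarrow> a < N \<Longrightarrow> (\<Sum>b<N. R i $$ (a, b)) = 1"
    and irreducible: "irreducible_nonneg_mat (cyclic_block_mat m N R)"
begin

lemma kernel_path:
  assumes "x \<in> {1..m} \<times> {..<N}" "y \<in> {1..m} \<times> {..<N}"
  shows "(x, y) \<in> {(x, y). x \<in> {1..m} \<times> {..<N} \<and> y \<in> {1..m} \<times> {..<N} \<and> 0 < urn_kernel m R x y}\<^sup>*"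
    (is "_ \<in> ?E\<^sup>*")
proof -
  let ?B = "cyclic_block_mat m N R"
  \<comment> \<open>\<open>f\<close> decodes a matrix index into urn and colour, and
    \<open>g\<close> encodes the pair again.\<close>
  define f where "f a = (a div N + 1, a mod N)" for a
  define g where "g x = (fst x - 1) * N + snd x" for x :: "nat \<times> nat"
  have B: "?B \<in> carrier_mat (N * m) (N * m)" by (simp add: cyclic_block_mat_def)
  have f: "f a \<in> {1..m} \<times> {..<N}" if "a < N * m" for a
    using that N less_mult_imp_div_less[of a m N] by (auto simp: f_def mult.commute)
  have fg: "g x < N * m \<and> f (g x) = x" if x: "x \<in> {1..m} \<times> {..<N}" for x
  proof -
    have "g x < (fst x - 1) * N + N" using x by (auto simp: g_def)
    also have "\<dots> = fst x * N" using x by (cases "fst x") auto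
    also have "\<dots> \<le> N * m" using x by (auto simp: mult.commute)
    finally show ?thesis using x by (auto simp: f_def g_def)
  qed
  have edge: "(f a, f b) \<in> ?E" if "a < N * m" "b < N * m" "0 < ?B $$ (a, b)" for a b
    using that f[of a] f[of b]
    by (auto simp: cyclic_block_mat_def urn_kernel_def f_def split: if_splits)
  obtain k where "0 < (?B ^\<^sub>m k) $$ (g x, g y)"
    using irreducible fg[OF assms(1)] fg[OF assms(2)] B
    unfolding irreducible_nonneg_mat_def by (metis carrier_matD(1))
  then have "(g x, g y) \<in> {(a, b). a < N * m \<and> b < N * m \<and> 0 < ?B $$ (a, b)}\<^sup>*"
    using irreducible B fg[OF assms(1)] fg[OF assms(2)]
    by (intro pow_mat_pos_imp_path[OF B]) (auto simp: irreducible_nonneg_mat_def)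
  then have "(f (g x), f (g y)) \<in> ?E\<^sup>*"
  proof (induction rule: rtrancl_induct)
    case (step b c)
    then show ?case using edge[of b c] by (auto intro: rtrancl_into_rtrancl)
  qed simp
  then show ?thesis using fg assms by simp
qed

sublocale kernel: irreducible_stochastic "{1..m} \<times> {..<N}" "urn_kernel m R"
proof
  fix a b assume "a \<in> {1..m} \<times> {..<N}" "b \<in> {1..m} \<times> {..<N}"
  then show "0 \<le> urn_kernel m R a b"
    using nonneg next_urn_in by (auto simp: urn_kernel_def)
next
  fix a assume "a \<in> {1..m} \<times> {..<N}"
  then show "(\<Sum>b\<in>{1..m} \<times> {..<N}. urn_kernel m R a b) = 1"
    using sum_urn_kernel_left[where r="fst a" and a="snd a"] row_sum next_urn_in by auto
qed (use kernel_path in auto)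

text \<open>Every urn has exactly one predecessor, so stationarity decouples into one vector
  equation per urn: the block of an urn times the next replacement matrix is the block of the next
  urn.\<close>

lemma stationary_iff:
  "kernel.stationary f \<longleftrightarrow> (\<forall>r\<in>{1..m}. \<forall>b<N.
    (\<Sum>j<N. f (r, j) * R (next_urn m r) $$ (j, b)) = f (next_urn m r, b))"
proof
  assume f: "kernel.stationary f"
  show "\<forall>r\<in>{1..m}. \<forall>b<N.
    (\<Sum>j<N. f (r, j) * R (next_urn m r) $$ (j, b)) = f (next_urn m r, b)"
  proof (intro ballI allI impI)
    fix r b assume r: "r \<in> {1..m}" and b: "b < N"
    then have "(next_urn m r, b) \<in> {1..m} \<times> {..<N}" using next_urn_in by simp
    then show "(\<Sum>j<N. f (r, j) * R (next_urn m r) $$ (j, b)) = f (next_urn m r, b)"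
      using f unfolding kernel.stationary_def sum_urn_kernel_right[OF r, symmetric] by blast
  qed
next
  assume *: "\<forall>r\<in>{1..m}. \<forall>b<N.
    (\<Sum>j<N. f (r, j) * R (next_urn m r) $$ (j, b)) = f (next_urn m r, b)"
  show "kernel.stationary f"
    unfolding kernel.stationary_def
  proof
    fix y assume y: "y \<in> {1..m} \<times> {..<N}"
    have "fst y \<in> {1..m}" using y by auto
    then obtain r where r: "r \<in> {1..m}" "fst y = next_urn m r"
      by (rule next_urn_surj)
    then have "y = (next_urn m r, snd y)" "snd y < N" using y by (auto simp: prod_eq_iff)
    then show "(\<Sum>a\<in>{1..m} \<times> {..<N}. f a * urn_kernel m R a y) = f y"
      using * r sum_urn_kernel_right[OF r(1), where b="snd y"] by metis
  qed
qed

text \<open>Row sums one preserve mass from each urn to the next. A single scalar therefore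
  normalises all blocks simultaneously.\<close>

lemma stationary_block_sum:
  assumes f: "kernel.stationary f" and i: "i \<in> {1..m}"
  shows "(\<Sum>j<N. f (i, j)) = (\<Sum>j<N. f (1, j))"
proof -
  have "i \<ge> 1" "i \<le> m" using i by auto
  then show ?thesis
  proof (induction i rule: dec_induct)
    case (step i)
    then have i: "i \<in> {1..m}" "next_urn m i = Suc i" "Suc i \<in> {1..m}" by (auto simp: next_urn_def)
    have "(\<Sum>b<N. f (Suc i, b)) = (\<Sum>b<N. \<Sum>j<N. f (i, j) * R (Suc i) $$ (j, b))"
      using f[unfolded stationary_iff, rule_format, OF i(1)] i(2) by (intro sum.cong) auto
    also have "\<dots> = (\<Sum>j<N. f (i, j))"
      by (subst sum.swap) (simp add: sum_distrib_left[symmetric] row_sum[OF i(3)])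
    finally show ?case using step by simp
  qed simp
qed

section \<open>Fixed vectors of the cyclic products and stationary vectors of the kernel\<close>

abbreviation urn_step :: "real vec \<Rightarrow> nat \<Rightarrow> real vec" where
  "urn_step w k \<equiv> transpose_mat (R k) *\<^sub>v w"

lemma urn_step_index:
  assumes "k \<in> {1..m}" "w \<in> carrier_vec N" "b < N"
  shows "urn_step w k $ b = (\<Sum>j<N. w $ j * R k $$ (j, b))"
  using carrier[OF assms(1)] assms
  by (auto simp: scalar_prod_def lessThan_atLeast0 mult.commute intro!: sum.cong)

lemma urn_step_carrier: "k \<in> {1..m} \<Longrightarrow> urn_step w k \<in> carrier_vec N"
  using carrier[of k] by (auto intro: carrier_vecI)

lemma cyclic_prod_carrier: "i \<in> {1..m} \<Longrightarrow> cyclic_prod m N R i \<in> carrier_mat N N"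
  unfolding cyclic_prod_def by (intro foldr_mat_mult_carrier carrier) auto

lemma transpose_cyclic_prod:
  assumes "i \<in> {1..m}" "v \<in> carrier_vec N"
  shows "transpose_mat (cyclic_prod m N R i) *\<^sub>v v =
    foldl urn_step v ([i + 1..<m + 1] @ [1..<i + 1])"
  unfolding cyclic_prod_def
  by (rule transpose_foldr_mat_mult) (use assms carrier in auto)

lemma cyclic_prod_fixed_of_cycle:
  assumes i: "i \<in> {1..m}"
    and step: "\<And>r. r \<in> {1..m} \<Longrightarrow> w (next_urn m r) = urn_step (w r) (next_urn m r)"
  shows "foldl urn_step (w i) ([i + 1..<m + 1] @ [1..<i + 1]) = w i"
proof -
  have *: "foldl urn_step (w a) [a + 1..<b + 1] = w b" if "1 \<le> a" "a \<le> b" "b \<le> m" for a b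
    using that(2,3)
  proof (induction b rule: dec_induct)
    case (step b)
    then show ?case using assms(2)[of b] that(1) by (auto simp: next_urn_def)
  qed simp
  \<comment> \<open>The step across the end of the numbering joins the run from \<open>i\<close> to
    \<open>m\<close> with the run from \<open>1\<close> to \<open>i\<close>.\<close>
  have "w 1 = urn_step (w m) 1" using step[of m] m by (simp add: next_urn_def)
  moreover have "[1..<i + 1] = 1 # [1 + 1..<i + 1]" using i by (simp add: upt_conv_Cons)
  ultimately show ?thesis using *[of i m] *[of 1 i] i by (simp del: upt_Suc)
qed

text \<open>The vectors of the other urns are obtained by applying initial segments of the cyclic
  product to \<open>v\<close>. Most cycle equations then hold by construction; the fixed point
  equation is what closes the cycle at \<open>i\<close>.\<close>

lemma cycle_of_cyclic_prod_fixed: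
  assumes i: "i \<in> {1..m}" and v: "v \<in> carrier_vec N"
    and fixed: "transpose_mat (cyclic_prod m N R i) *\<^sub>v v = v"
  obtains w where "w i = v" "\<And>r. r \<in> {1..m} \<Longrightarrow> w r \<in> carrier_vec N"
    "\<And>r. r \<in> {1..m} \<Longrightarrow> w (next_urn m r) = urn_step (w r) (next_urn m r)"
proof -
  \<comment> \<open>The factors met on the way from urn \<open>i\<close> to urn \<open>k\<close>,
    passing the end of the numbering if \<open>k < i\<close>; empty for \<open>k = i\<close>, so
    that \<open>w i = v\<close>.\<close>
  define l where "l k = (if i \<le> k then [i + 1..<k + 1] else [i + 1..<m + 1] @ [1..<k + 1])" for k
  define w where "w k = foldl urn_step v (l k)" for k
  have v_eq: "v = foldl urn_step v ([i + 1..<m + 1] @ [1..<i + 1])"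
    using fixed transpose_cyclic_prod[OF i v] by simp
  have wi: "w i = v" by (simp add: w_def l_def)
  have carr: "foldl urn_step u ks \<in> carrier_vec N"
    if "set ks \<subseteq> {1..m}" "u \<in> carrier_vec N" for u ks
    using that by (induction ks arbitrary: u) (auto simp: urn_step_carrier)
  have "w (next_urn m r) = urn_step (w r) (next_urn m r)" if r: "r \<in> {1..m}" for r
  proof (cases "next_urn m r = i")
    case True
    have "[i + 1..<m + 1] @ [1..<i + 1] = l r @ [i]"
      using True r i by (auto simp: l_def next_urn_def split: if_splits)
    then show ?thesis using True wi v_eq by (simp add: w_def)
  next
    case False
    have "l (next_urn m r) = l r @ [next_urn m r]"
      using False r i by (auto simp: l_def next_urn_def split: if_splits)
    then show ?thesis by (simp add: w_def)
  qed
  moreover have "w r \<in> carrier_vec N" if "r \<in> {1..m}" for r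
    unfolding w_def using that i v by (intro carr) (auto simp: l_def)
  ultimately show thesis using that wi by blast
qed

lemma stationary_of_cyclic_prod_fixed:
  assumes i: "i \<in> {1..m}" and v: "v \<in> carrier_vec N"
    and fixed: "transpose_mat (cyclic_prod m N R i) *\<^sub>v v = v"
  obtains f where "kernel.stationary f" "\<And>j. f (i, j) = v $ j"
proof -
  obtain w where w: "w i = v" "\<And>r. r \<in> {1..m} \<Longrightarrow> w r \<in> carrier_vec N"
    "\<And>r. r \<in> {1..m} \<Longrightarrow> w (next_urn m r) = urn_step (w r) (next_urn m r)"
    using cycle_of_cyclic_prod_fixed[OF assms] by blast
  have "kernel.stationary (\<lambda>x. w (fst x) $ snd x)"
    unfolding stationary_iff using w next_urn_in urn_step_index by simp
  then show thesis using that w(1) by simp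
qed

text \<open>The all-ones vector is a right eigenvector, and a matrix and its transpose share their
  characteristic polynomial. Nothing is known yet about the signs of the resulting left
  eigenvector.\<close>

lemma cyclic_prod_fixed_exists:
  assumes i: "i \<in> {1..m}"
  obtains v where "v \<in> carrier_vec N" "v \<noteq> 0\<^sub>v N"
    "transpose_mat (cyclic_prod m N R i) *\<^sub>v v = v"
proof -
  let ?A = "cyclic_prod m N R i"
  let ?e = "vec N (\<lambda>_. 1 :: real)"
  note A = cyclic_prod_carrier[OF i]
  have one: "R k *\<^sub>v ?e = ?e" if "k \<in> {1..m}" for k
    using carrier[OF that] row_sum[OF that]
    by (intro eq_vecI) (auto simp: scalar_prod_def lessThan_atLeast0)
  have *: "foldr (\<lambda>k A. R k * A) ks (1\<^sub>m N) *\<^sub>v ?e = ?e" if "set ks \<subseteq> {1..m}" for ks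
    using that
  proof (induction ks)
    case (Cons k ks)
    then have "foldr (\<lambda>k A. R k * A) ks (1\<^sub>m N) \<in> carrier_mat N N"
      by (intro foldr_mat_mult_carrier carrier) auto
    then have "R k * foldr (\<lambda>k A. R k * A) ks (1\<^sub>m N) *\<^sub>v ?e = R k *\<^sub>v (foldr (\<lambda>k A. R k * A) ks (1\<^sub>m N) *\<^sub>v ?e)"
      using carrier[of k] Cons.prems by (intro assoc_mult_mat_vec) auto
    with Cons one show ?case by simp
  qed simp
  have "?A *\<^sub>v ?e = ?e"
    unfolding cyclic_prod_def by (rule *) (use i in auto)
  moreover have "?e \<noteq> 0\<^sub>v N"
  proof
    assume "?e = 0\<^sub>v N"
    then have "?e $ 0 = 0\<^sub>v N $ 0" by simp
    then show False using N by simp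
  qed
  ultimately have "eigenvalue ?A 1"
    using A unfolding eigenvalue_def eigenvector_def by (intro exI[of _ ?e]) auto
  then have "eigenvalue (transpose_mat ?A) 1"
    using A by (simp add: eigenvalue_root_char_poly[of _ N])
  then show thesis
    using that A unfolding eigenvalue_def eigenvector_def by auto
qed

text \<open>A fixed vector at urn 1 lifts to a stationary vector, whose absolute value is stationary
  and, by irreducibility, positive. Division by the mass of block 1 normalises every block.\<close>

lemma stationary_distribution_exists:
  obtains \<mu> where "kernel.stationary \<mu>" "\<And>x. x \<in> {1..m} \<times> {..<N} \<Longrightarrow> 0 < \<mu> x"
    "\<And>i. i \<in> {1..m} \<Longrightarrow> (\<Sum>j<N. \<mu> (i, j)) = 1"
proof -
  have 1: "1 \<in> {1..m}" using m by simp
  obtain v where v: "v \<in> carrier_vec N" "v \<noteq> 0\<^sub>v N" "transpose_mat (cyclic_prod m N R 1) *\<^sub>v v = v"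
    using cyclic_prod_fixed_exists[OF 1] .
  obtain f where f: "kernel.stationary f" "\<And>j. f (1, j) = v $ j"
    using stationary_of_cyclic_prod_fixed[OF 1 v(1,3)] by blast
  obtain j where j: "j < N" "v $ j \<noteq> 0"
    using v(1,2) by (metis carrier_vecD eq_vecI index_zero_vec(1) index_zero_vec(2))
  define s where "s = (\<Sum>j<N. \<bar>f (1, j)\<bar>)"
  have pos: "0 < \<bar>f x\<bar>" if "x \<in> {1..m} \<times> {..<N}" for x
    using kernel.stationary_positive_abs[OF f(1), of "(1, j)" x] that j f(2) 1 by auto
  have s: "0 < s" unfolding s_def using N pos 1 by (intro sum_pos) (auto simp: lessThan_empty_iff)
  let ?\<mu> = "\<lambda>x. \<bar>f x\<bar> / s"
  have a: "kernel.stationary (\<lambda>x. \<bar>f x\<bar>)" using kernel.stationary_abs f by blast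
  then have "kernel.stationary ?\<mu>"
    unfolding stationary_iff by (simp add: sum_divide_distrib[symmetric])
  moreover have "(\<Sum>j<N. ?\<mu> (i, j)) = 1" if "i \<in> {1..m}" for i
    using stationary_block_sum[OF a that] s by (simp add: s_def sum_divide_distrib[symmetric])
  ultimately show thesis using pos s by (intro that[of ?\<mu>]) auto
qed

text \<open>An eigenvector of the product lifts to a stationary vector of the block kernel, hence is
  a multiple of \<open>\<mu>\<close> on urn \<open>i\<close>, and both have mass one. Irreducibility
  thus acts through the block kernel, not through the product itself.\<close>

lemma normalized_left_eigenvector_cyclic_prod_iff:
  assumes i: "i \<in> {1..m}" and \<mu>: "kernel.stationary \<mu>"
    and pos: "\<And>x. x \<in> {1..m} \<times> {..<N} \<Longrightarrow> 0 < \<mu> x"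
    and sum: "(\<Sum>j<N. \<mu> (i, j)) = 1"
  shows "normalized_left_eigenvector_1 (cyclic_prod m N R i) v \<longleftrightarrow> v = vec N (\<lambda>j. \<mu> (i, j))"
proof
  assume "normalized_left_eigenvector_1 (cyclic_prod m N R i) v"
  then have v: "v \<in> carrier_vec N" "transpose_mat (cyclic_prod m N R i) *\<^sub>v v = v" "(\<Sum>j<N. v $ j) = 1"
    using cyclic_prod_carrier[OF i]
    by (auto simp: normalized_left_eigenvector_1_def eigenvector_def)
  obtain f where f: "kernel.stationary f" "\<And>j. f (i, j) = v $ j"
    using stationary_of_cyclic_prod_fixed[OF i v(1,2)] by blast
  define c where "c = f (i, 0) / \<mu> (i, 0)"
  have x0: "(i, 0) \<in> {1..m} \<times> {..<N}" using i N by auto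
  have vj: "v $ j = c * \<mu> (i, j)" if "j < N" for j
    using kernel.stationary_proportional[OF f(1) \<mu> x0, of "(i, j)"] pos[OF x0] that i f(2)
    by (auto simp: c_def)
  have "1 = (\<Sum>j<N. c * \<mu> (i, j))" using v(3) vj by simp
  then have "c = 1" using sum by (simp add: sum_distrib_left[symmetric])
  then show "v = vec N (\<lambda>j. \<mu> (i, j))" using v(1) vj by (intro eq_vecI) auto
next
  assume v: "v = vec N (\<lambda>j. \<mu> (i, j))"
  define w where "w r = vec N (\<lambda>j. \<mu> (r, j))" for r
  have "w (next_urn m r) = urn_step (w r) (next_urn m r)" if r: "r \<in> {1..m}" for r
  proof (rule eq_vecI)
    show "dim_vec (w (next_urn m r)) = dim_vec (urn_step (w r) (next_urn m r))"
      using carrier[OF next_urn_in[OF r]] by (simp add: w_def)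
    fix b assume "b < dim_vec (urn_step (w r) (next_urn m r))"
    then have "b < N" using carrier[OF next_urn_in[OF r]] by simp
    then show "w (next_urn m r) $ b = urn_step (w r) (next_urn m r) $ b"
      using \<mu> r next_urn_in[OF r] unfolding stationary_iff
      by (subst urn_step_index) (auto simp: w_def)
  qed
  then have "transpose_mat (cyclic_prod m N R i) *\<^sub>v v = v"
    using transpose_cyclic_prod[OF i, of v] cyclic_prod_fixed_of_cycle[OF i, of w]
    by (simp add: w_def v)
  moreover have "v \<noteq> 0\<^sub>v N"
  proof
    assume "v = 0\<^sub>v N"
    then have "v $ 0 = 0" using N by simp
    then show False using pos[of "(i, 0)"] i N by (simp add: v)
  qed
  ultimately show "normalized_left_eigenvector_1 (cyclic_prod m N R i) v"
    using cyclic_prod_carrier[OF i] sum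
    by (simp add: normalized_left_eigenvector_1_def eigenvector_def v)
qed

end

section \<open>The urn process\<close>

text \<open>Here \<open>s\<close> stands for step \<open>s + 1\<close>, so urn \<open>r\<close> is
  sampled at \<open>s = m * q + r - 1\<close>. Exactly \<open>k + 1\<close> of these values,
  \<open>q = 0\<close> included, lie among the first \<open>m * k + r\<close> steps.\<close>

lemma cycle_position_unique:
  fixes m r s k :: nat
  assumes "r \<in> {1..m}"
  shows "s mod m = r - 1 \<and> s < m * k + r \<longleftrightarrow> (\<exists>q\<le>k. s = m * q + r - 1)"
proof
  assume *: "s mod m = r - 1 \<and> s < m * k + r"
  then have s: "s = m * (s div m) + (r - 1)" by (metis mult_div_mod_eq)
  have "\<not> k < s div m"
  proof
    assume "k < s div m"
    then have "m * Suc k \<le> m * (s div m)" by (intro mult_le_mono2) simp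
    then show False using s * assms by auto
  qed
  then show "\<exists>q\<le>k. s = m * q + r - 1" using s assms by (intro exI[of _ "s div m"]) auto
next
  assume "\<exists>q\<le>k. s = m * q + r - 1"
  then obtain q where q: "q \<le> k" "s = m * q + (r - 1)" using assms by auto
  obtain r' where r': "r = Suc r'" "r' < m" using assms by (cases r) auto
  have "m * q \<le> m * k" using q(1) by simp
  then show "s mod m = r - 1 \<and> s < m * k + r" using q(2) r' by (simp add: less_Suc_eq_le)
qed

lemma sum_over_cycle_position:
  fixes f :: "nat \<Rightarrow> real"
  assumes r: "r \<in> {1..m}"
  shows "(\<Sum>s<m * k + r. if next_urn m r = next_urn m (sampled_urn m (Suc s)) then f s else 0) =
    (\<Sum>q\<le>k. f (m * q + r - 1))"
proof -
  have mpos: "0 < m" using r by auto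
  have inj: "inj_on (\<lambda>q. m * q + r - 1) {..k}"
    using r mpos by (cases r) (auto intro!: inj_onI)
  have "next_urn m r = next_urn m (sampled_urn m (Suc s)) \<longleftrightarrow> s mod m = r - 1" for s
  proof -
    have "sampled_urn m (Suc s) \<in> {1..m}"
      using mpos by (auto simp: sampled_urn_def Suc_le_eq)
    then show ?thesis using next_urn_eq_iff[OF r] r by (auto simp: sampled_urn_def)
  qed
  then have "(\<Sum>s<m * k + r. if next_urn m r = next_urn m (sampled_urn m (Suc s)) then f s else 0) =
      (\<Sum>s | s mod m = r - 1 \<and> s < m * k + r. f s)"
    by (simp add: sum.If_cases) (intro sum.cong, auto)
  also have "{s. s mod m = r - 1 \<and> s < m * k + r} = (\<lambda>q. m * q + r - 1) ` {..k}"
    unfolding cycle_position_unique[OF r] by auto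
  also have "(\<Sum>s\<in>(\<lambda>q. m * q + r - 1) ` {..k}. f s) = (\<Sum>q\<le>k. f (m * q + r - 1))"
    by (simp only: sum.reindex[OF inj] o_def)
  finally show ?thesis .
qed

section \<open>Compositions, totals and proportions\<close>

locale stochastic_cyclic_urn = cyclic_urn_model M F m N R C0 draw C + cyclic_replacement m N R
  for M :: "'a measure" and F m N R C0 draw C +
  assumes init_pos: "i \<in> {1..m} \<Longrightarrow> (\<Sum>j<N. C0 i $ j) > 0"
begin

lemma draw_less: "n \<ge> 1 \<Longrightarrow> \<omega> \<in> space M \<Longrightarrow> draw n \<omega> < N"
  using measurable_space[OF draw_measurable[of n]] by (auto simp: space_F)

lemma dim_composition: "\<omega> \<in> space M \<Longrightarrow> i \<in> {1..m} \<Longrightarrow> dim_vec (C n i \<omega>) = N"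
proof (induction n)
  case 0
  then show ?case using init_carrier by (simp add: composition_0)
next
  case (Suc n)
  then show ?case using carrier[of i] by (auto simp: composition_step)
qed

lemma composition_eq:
  assumes "\<omega> \<in> space M" "i \<in> {1..m}" "j < N"
  shows "C n i \<omega> $ j = C0 i $ j +
    (\<Sum>s<n. if i = next_urn m (sampled_urn m (Suc s)) then R i $$ (draw (Suc s) \<omega>, j) else 0)"
proof (induction n)
  case 0
  then show ?case using assms by (simp add: composition_0)
next
  case (Suc n)
  have "row (R i) (draw (Suc n) \<omega>) $ j = R i $$ (draw (Suc n) \<omega>, j)"
    using carrier[OF assms(2)] draw_less[of "Suc n" \<omega>] assms by simp
  then have "C (Suc n) i \<omega> $ j = C n i \<omega> $ j +
      (if i = next_urn m (sampled_urn m (Suc n)) then R i $$ (draw (Suc n) \<omega>, j) else 0)"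
    unfolding composition_step[OF assms(1,2)] using assms(3) carrier[OF assms(2)] by auto
  then show ?case using Suc by simp
qed

lemma composition_nonneg:
  assumes "\<omega> \<in> space M" "i \<in> {1..m}" "j < N"
  shows "0 \<le> C n i \<omega> $ j"
  unfolding composition_eq[OF assms]
  using assms init_nonneg nonneg draw_less
  by (intro add_nonneg_nonneg sum_nonneg) auto

lemma composition_next_urn:
  assumes "\<omega> \<in> space M" "r \<in> {1..m}" "j < N"
  shows "C (m * k + r) (next_urn m r) \<omega> $ j = C0 (next_urn m r) $ j +
    (\<Sum>q\<le>k. R (next_urn m r) $$ (draw (m * q + r) \<omega>, j))"
  using assms next_urn_in[OF assms(2)]
  by (simp add: composition_eq sum_over_cycle_position)

text \<open>Whatever colour is drawn, the added row has mass one. Totals are therefore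
  deterministic, and only their split into colours is random.\<close>

lemma total_eq:
  assumes "\<omega> \<in> space M" "i \<in> {1..m}"
  shows "(\<Sum>j<N. C n i \<omega> $ j) = (\<Sum>j<N. C0 i $ j) +
    (\<Sum>s<n. if i = next_urn m (sampled_urn m (Suc s)) then 1 else 0)"
proof -
  have "(\<Sum>j<N. \<Sum>s<n. if i = next_urn m (sampled_urn m (Suc s)) then R i $$ (draw (Suc s) \<omega>, j) else 0)
      = (\<Sum>s<n. \<Sum>j<N. if i = next_urn m (sampled_urn m (Suc s)) then R i $$ (draw (Suc s) \<omega>, j) else 0)"
    by (rule sum.swap)
  also have "\<dots> = (\<Sum>s<n. if i = next_urn m (sampled_urn m (Suc s)) then 1 else 0)"
    using assms row_sum draw_less by (intro sum.cong) auto
  finally show ?thesis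
    using assms by (simp add: composition_eq sum.distrib)
qed

lemma total_pos:
  assumes "\<omega> \<in> space M" "i \<in> {1..m}"
  shows "0 < (\<Sum>j<N. C n i \<omega> $ j)"
  unfolding total_eq[OF assms] using init_pos[OF assms(2)]
  by (intro add_pos_nonneg sum_nonneg) auto

lemma total_next_urn:
  assumes "\<omega> \<in> space M" "r \<in> {1..m}"
  shows "(\<Sum>j<N. C (m * k + r) (next_urn m r) \<omega> $ j) =
    (\<Sum>j<N. C0 (next_urn m r) $ j) + (real k + 1)"
  using assms next_urn_in[OF assms(2)]
  by (simp add: total_eq sum_over_cycle_position)

lemma proportion_eq:
  "\<omega> \<in> space M \<Longrightarrow> i \<in> {1..m} \<Longrightarrow>
    proportion (C n i \<omega>) j = C n i \<omega> $ j / (\<Sum>j<N. C n i \<omega> $ j)"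
  by (simp add: proportion_def dim_composition)

lemma proportion_bounds:
  assumes "\<omega> \<in> space M" "i \<in> {1..m}" "j < N"
  shows "proportion (C n i \<omega>) j \<in> {0..1}"
proof -
  have "C n i \<omega> $ j \<le> (\<Sum>j<N. C n i \<omega> $ j)"
    using assms composition_nonneg by (intro member_le_sum) auto
  then show ?thesis
    using assms total_pos[OF assms(1,2), of n] composition_nonneg[OF assms, of n]
    by (simp add: proportion_eq)
qed

lemma sum_proportion:
  assumes "\<omega> \<in> space M" "i \<in> {1..m}"
  shows "(\<Sum>j<N. proportion (C n i \<omega>) j) = 1"
  using total_pos[OF assms, of n] assms
  by (simp add: proportion_eq sum_divide_distrib[symmetric])

text \<open>The proportions in urn \<open>fst x\<close> just before it is sampled for the \<open>(k + 1)\<close>-st time.\<close>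

definition sampled_proportion :: "nat \<Rightarrow> nat \<times> nat \<Rightarrow> 'a \<Rightarrow> real" where
  "sampled_proportion k x \<omega> = proportion (C (m * k + fst x - 1) (fst x) \<omega>) (snd x)"

definition mean_proportion :: "nat \<Rightarrow> nat \<times> nat \<Rightarrow> 'a \<Rightarrow> real" where
  "mean_proportion k x \<omega> = (\<Sum>q\<le>k. sampled_proportion q x \<omega>) / real (k + 1)"

lemma sampled_proportion_bounds:
  "\<omega> \<in> space M \<Longrightarrow> x \<in> {1..m} \<times> {..<N} \<Longrightarrow> sampled_proportion k x \<omega> \<in> {0..1}"
  unfolding sampled_proportion_def by (intro proportion_bounds) auto

lemma mean_proportion_bounds:
  assumes "\<omega> \<in> space M" "x \<in> {1..m} \<times> {..<N}"
  shows "mean_proportion k x \<omega> \<in> {0..1}"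
proof -
  have "(\<Sum>q\<le>k. sampled_proportion q x \<omega>) \<le> (\<Sum>q\<le>k. 1)"
    using sampled_proportion_bounds[OF assms] by (intro sum_mono) auto
  moreover have "0 \<le> (\<Sum>q\<le>k. sampled_proportion q x \<omega>)"
    using sampled_proportion_bounds[OF assms] by (intro sum_nonneg) auto
  ultimately show ?thesis by (simp add: mean_proportion_def)
qed

lemma sum_mean_proportion:
  assumes "\<omega> \<in> space M"
  shows "(\<Sum>x\<in>{1..m} \<times> {..<N}. mean_proportion k x \<omega>) = real m"
proof -
  have "(\<Sum>j<N. mean_proportion k (i, j) \<omega>) = 1" if "i \<in> {1..m}" for i
  proof -
    have "(\<Sum>j<N. mean_proportion k (i, j) \<omega>) =
        (\<Sum>q\<le>k. \<Sum>j<N. sampled_proportion q (i, j) \<omega>) / real (k + 1)"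
      unfolding mean_proportion_def by (subst sum.swap) (simp add: sum_divide_distrib)
    then show ?thesis using sum_proportion[OF assms that] by (simp add: sampled_proportion_def)
  qed
  moreover have "(\<Sum>x\<in>{1..m} \<times> {..<N}. mean_proportion k x \<omega>) =
      (\<Sum>i\<in>{1..m}. \<Sum>j<N. mean_proportion k (i, j) \<omega>)"
    by (simp add: sum.cartesian_product case_prod_beta)
  ultimately show ?thesis by simp
qed

lemma mean_proportion_Suc:
  "mean_proportion (Suc k) x \<omega> = mean_proportion k x \<omega> +
    (sampled_proportion (Suc k) x \<omega> - mean_proportion k x \<omega>) / real (k + 2)"
proof -
  have "(\<Sum>q\<le>k. sampled_proportion q x \<omega>) = mean_proportion k x \<omega> * real (k + 1)"
    by (simp add: mean_proportion_def)
  then have "mean_proportion (Suc k) x \<omega> =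
      (mean_proportion k x \<omega> * real (k + 1) + sampled_proportion (Suc k) x \<omega>) / real (k + 2)"
    by (simp add: mean_proportion_def[of "Suc k"])
  also have "\<dots> = mean_proportion k x \<omega> +
      (sampled_proportion (Suc k) x \<omega> - mean_proportion k x \<omega>) / real (k + 2)"
    by (simp add: field_simps)
  finally show ?thesis .
qed

text \<open>An indicator minus its conditional probability given the past is orthogonal to every
  bounded variable of that past, in particular to the earlier such differences for the same urn. So
  the strong law for uncorrelated variables applies.\<close>

lemma draws_law_of_large_numbers:
  assumes r: "r \<in> {1..m}" and j: "j < N"
  shows "AE \<omega> in M. (\<lambda>k. (\<Sum>q\<le>k. indicat_real {\<omega> \<in> space M. draw (m * q + r) \<omega> = j} \<omega>
    - sampled_proportion q (r, j) \<omega>) / real (k + 1)) \<longlonglongrightarrow> 0"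
proof -
  define A where "A q = {\<omega> \<in> space M. draw (m * q + r) \<omega> = j}" for q
  define G where "G q = F (m * q + r - 1)" for q
  \<comment> \<open>Centring by the conditional expectation itself makes adaptedness immediate. The
    proportion, equal to it only almost everywhere, is substituted at the end.\<close>
  define X where "X q \<omega> = indicat_real (A q) \<omega> - real_cond_exp M (G q) (indicator (A q)) \<omega>" for q \<omega>
  have sub: "subalgebra (F n) (F l)" if "l \<le> n" for l n
    using that sets_F_mono by (simp add: subalgebra_def space_F)
  have sfin: "sigma_finite_subalgebra M (G q)" for q
    unfolding G_def
    by (intro finite_measure_subalgebra_is_sigma_finite)
      (simp add: finite_measure_subalgebra_def finite_measure_subalgebra_axioms_def
        finite_measure_axioms subalg)
  have A_F: "A q \<in> sets (F (m * q + r))" for q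
  proof -
    have "draw (m * q + r) -` {j} \<inter> space (F (m * q + r)) \<in> sets (F (m * q + r))"
      using r j by (intro measurable_sets[OF draw_measurable]) auto
    moreover have "A q = draw (m * q + r) -` {j} \<inter> space (F (m * q + r))"
      by (auto simp: A_def space_F)
    ultimately show ?thesis by simp
  qed
  have A [measurable]: "A q \<in> sets M" for q
    using A_F subalg by (auto simp: subalgebra_def)
  have X_F: "X q \<in> borel_measurable (F (m * q + r))" for q
  proof -
    have "real_cond_exp M (G q) (indicator (A q)) \<in> borel_measurable (F (m * q + r))"
      unfolding G_def by (rule measurable_from_subalg[OF sub borel_measurable_cond_exp]) simp
    then show ?thesis
      unfolding X_def by (intro borel_measurable_diff borel_measurable_indicator A_F)
  qed
  have X [measurable]: "X q \<in> borel_measurable M" for q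
    by (rule measurable_from_subalg[OF subalg X_F])
  have cond: "AE \<omega> in M. real_cond_exp M (G q) (indicator (A q)) \<omega> = sampled_proportion q (r, j) \<omega>" for q
  proof -
    have "Suc (m * q + r - 1) = m * q + r" using r by simp
    moreover have "sampled_urn m (m * q + r) = r"
      using r by (cases r) (auto simp: sampled_urn_def)
    ultimately show ?thesis
      using draw_prob[OF j, of "m * q + r - 1"] by (simp add: A_def G_def sampled_proportion_def)
  qed
  have bound: "AE \<omega> in M. \<bar>X q \<omega>\<bar> \<le> 1" for q
    using cond[of q] AE_space
  proof eventually_elim
    case (elim \<omega>)
    then have "sampled_proportion q (r, j) \<omega> \<in> {0..1}"
      using r j by (intro sampled_proportion_bounds) auto
    then show ?case using elim by (auto simp: X_def indicator_def)
  qed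
  have orth: "expectation (\<lambda>\<omega>. X p \<omega> * X q \<omega>) = 0" if "p < q" for p q
  proof -
    interpret sigma_finite_subalgebra M "G q" by (rule sfin)
    \<comment> \<open>Draw \<open>m * p + r\<close> is at least one full round earlier than draw
      \<open>m * q + r\<close>, so it belongs to the past \<open>G q\<close> of the latter.\<close>
    have "m * p + m \<le> m * q" using that by (metis mult_Suc_right add.commute Suc_leI mult_le_mono2)
    then have "m * p + r \<le> m * q + r - 1" using r by auto
    then have XG: "X p \<in> borel_measurable (G q)"
      unfolding G_def by (intro measurable_from_subalg[OF sub X_F])
    have int: "integrable M (\<lambda>\<omega>. X p \<omega> * indicat_real (A q) \<omega>)"
    proof (rule integrable_const_bound[where B=1])
      show "AE \<omega> in M. norm (X p \<omega> * indicat_real (A q) \<omega>) \<le> 1"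
        using bound[of p] by eventually_elim (auto simp: indicator_def)
    qed simp
    note ce = real_cond_exp_intg[OF int XG borel_measurable_indicator[OF A]]
    have "expectation (\<lambda>\<omega>. X p \<omega> * X q \<omega>) = expectation (\<lambda>\<omega>. X p \<omega> * indicat_real (A q) \<omega>
        - X p \<omega> * real_cond_exp M (G q) (indicator (A q)) \<omega>)"
      by (simp add: X_def right_diff_distrib)
    also have "\<dots> = 0" using int ce by simp
    finally show ?thesis .
  qed
  have "AE \<omega> in M. (\<lambda>n. (\<Sum>q<n. X q \<omega>) / real n) \<longlonglongrightarrow> 0"
    by (rule strong_law_bounded_uncorrelated[OF X bound orth])
  moreover have "AE \<omega> in M. \<forall>q. real_cond_exp M (G q) (indicator (A q)) \<omega> = sampled_proportion q (r, j) \<omega>"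
    using cond by (simp add: AE_all_countable)
  ultimately show ?thesis
  proof eventually_elim
    case (elim \<omega>)
    have "(\<lambda>k. (\<Sum>q<Suc k. X q \<omega>) / real (Suc k)) \<longlonglongrightarrow> 0"
      using elim(1) by (rule LIMSEQ_Suc)
    moreover have "X q \<omega> = indicat_real (A q) \<omega> - sampled_proportion q (r, j) \<omega>" for q
      using elim(2) by (simp add: X_def)
    ultimately show ?case
      unfolding lessThan_Suc_atMost by (simp only: A_def Suc_eq_plus1)
  qed
qed

section \<open>From the draws to the recursion for the proportions\<close>

lemma mean_proportion_diff_tendsto_0:
  assumes "\<omega> \<in> space M" "x \<in> {1..m} \<times> {..<N}"
  shows "(\<lambda>k. mean_proportion (Suc k) x \<omega> - mean_proportion k x \<omega>) \<longlonglongrightarrow> 0"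
proof (rule Lim_null_comparison)
  have "\<bar>sampled_proportion (Suc k) x \<omega> - mean_proportion k x \<omega>\<bar> \<le> 1" for k
    using sampled_proportion_bounds[OF assms, of "Suc k"] mean_proportion_bounds[OF assms, of k] by auto
  then have "\<bar>sampled_proportion (Suc k) x \<omega> - mean_proportion k x \<omega>\<bar> / real (k + 2) \<le> 1 / real (k + 2)" for k
    by (intro divide_right_mono) auto
  then show "\<forall>\<^sub>F k in sequentially.
      norm (mean_proportion (Suc k) x \<omega> - mean_proportion k x \<omega>) \<le> 1 / real (k + 2)"
    by (simp add: mean_proportion_Suc)
  show "(\<lambda>k. 1 / real (k + 2)) \<longlonglongrightarrow> 0"
    by (rule LIMSEQ_ignore_initial_segment[OF lim_const_over_n])
qed

text \<open>Proportion times total is the composition, that is, the initial content plus the rows of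
  the drawn colours. Dividing by \<open>k + 1\<close> leaves three vanishing terms: the initial
  content of colour \<open>b\<close>, the sampling errors \<open>d\<close>, and the share of the
  initial total \<open>T\<close>.\<close>

lemma proportion_next_urn_tendsto:
  assumes \<omega>: "\<omega> \<in> space M" and r: "r \<in> {1..m}" and b: "b < N"
    and lln: "\<And>j. j < N \<Longrightarrow> (\<lambda>k. (\<Sum>q\<le>k. indicat_real {\<omega> \<in> space M. draw (m * q + r) \<omega> = j} \<omega>
      - sampled_proportion q (r, j) \<omega>) / real (k + 1)) \<longlonglongrightarrow> 0"
  shows "(\<lambda>k. proportion (C (m * k + r) (next_urn m r) \<omega>) b
    - (\<Sum>j<N. mean_proportion k (r, j) \<omega> * R (next_urn m r) $$ (j, b))) \<longlonglongrightarrow> 0"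
proof -
  define i where "i = next_urn m r"
  have i: "i \<in> {1..m}" using next_urn_in[OF r] by (simp add: i_def)
  define T where "T = (\<Sum>j<N. C0 i $ j)"
  define p where "p k = proportion (C (m * k + r) i \<omega>) b" for k
  define d where "d k j = (\<Sum>q\<le>k. indicat_real {\<omega> \<in> space M. draw (m * q + r) \<omega> = j} \<omega>
      - sampled_proportion q (r, j) \<omega>) / real (k + 1)" for k j
  have T: "0 < T" using init_pos[OF i] by (simp add: T_def)
  have eq: "p k - (\<Sum>j<N. mean_proportion k (r, j) \<omega> * R i $$ (j, b)) =
      C0 i $ b / real (k + 1) + (\<Sum>j<N. d k j * R i $$ (j, b)) - p k * (T / real (k + 1))" for k
  proof -
    have draws: "(\<Sum>q\<le>k. R i $$ (draw (m * q + r) \<omega>, b)) =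
        (\<Sum>j<N. (\<Sum>q\<le>k. indicat_real {\<omega> \<in> space M. draw (m * q + r) \<omega> = j} \<omega>) * R i $$ (j, b))"
    proof -
      have "R i $$ (draw (m * q + r) \<omega>, b) =
          (\<Sum>j<N. indicat_real {\<omega> \<in> space M. draw (m * q + r) \<omega> = j} \<omega> * R i $$ (j, b))" for q
      proof -
        have "(\<Sum>j<N. indicat_real {\<omega> \<in> space M. draw (m * q + r) \<omega> = j} \<omega> * R i $$ (j, b)) =
            (\<Sum>j<N. if j = draw (m * q + r) \<omega> then R i $$ (j, b) else 0)"
          using \<omega> by (intro sum.cong) (auto simp: indicator_def)
        also have "\<dots> = R i $$ (draw (m * q + r) \<omega>, b)"
          using draw_less[of "m * q + r" \<omega>] \<omega> r by simp
        finally show ?thesis by simp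
      qed
      then have "(\<Sum>q\<le>k. R i $$ (draw (m * q + r) \<omega>, b)) =
        (\<Sum>q\<le>k. \<Sum>j<N. indicat_real {\<omega> \<in> space M. draw (m * q + r) \<omega> = j} \<omega> * R i $$ (j, b))"
        by simp
      also have "\<dots> = (\<Sum>j<N. (\<Sum>q\<le>k. indicat_real {\<omega> \<in> space M. draw (m * q + r) \<omega> = j} \<omega>) * R i $$ (j, b))"
        by (subst sum.swap) (simp add: sum_distrib_right)
      finally show ?thesis .
    qed
    have "p k * (T + (real k + 1)) = C (m * k + r) i \<omega> $ b"
      using total_next_urn[OF \<omega> r, of k] T \<omega> i unfolding p_def
      by (simp add: proportion_eq i_def[symmetric] T_def[symmetric])
    also have "\<dots> = C0 i $ b + (\<Sum>q\<le>k. R i $$ (draw (m * q + r) \<omega>, b))"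
      using composition_next_urn[OF \<omega> r b, of k] by (simp add: i_def)
    finally have "p k * (T + (real k + 1)) / real (k + 1) =
        (C0 i $ b + (\<Sum>q\<le>k. R i $$ (draw (m * q + r) \<omega>, b))) / real (k + 1)"
      by simp
    moreover have "p k * (T + (real k + 1)) / real (k + 1) = p k * (T / real (k + 1)) + p k"
      by (simp add: field_simps)
    moreover have "(\<Sum>q\<le>k. R i $$ (draw (m * q + r) \<omega>, b)) / real (k + 1) =
        (\<Sum>j<N. d k j * R i $$ (j, b)) + (\<Sum>j<N. mean_proportion k (r, j) \<omega> * R i $$ (j, b))"
    proof -
      have "(\<Sum>q\<le>k. indicat_real {\<omega> \<in> space M. draw (m * q + r) \<omega> = j} \<omega>) =
          (d k j + mean_proportion k (r, j) \<omega>) * real (k + 1)" for j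
        by (simp add: d_def mean_proportion_def sum_subtractf add_divide_distrib[symmetric])
      then have "(\<Sum>q\<le>k. R i $$ (draw (m * q + r) \<omega>, b)) =
          (\<Sum>j<N. (d k j + mean_proportion k (r, j) \<omega>) * R i $$ (j, b)) * real (k + 1)"
        unfolding draws by (simp add: sum_distrib_right sum_distrib_left algebra_simps)
      then have "(\<Sum>q\<le>k. R i $$ (draw (m * q + r) \<omega>, b)) / real (k + 1) =
          (\<Sum>j<N. (d k j + mean_proportion k (r, j) \<omega>) * R i $$ (j, b))"
        by simp
      then show ?thesis by (simp add: distrib_right sum.distrib)
    qed
    ultimately show ?thesis by (simp only: add_divide_distrib)
  qed
  have const: "(\<lambda>k. c / real (k + 1)) \<longlonglongrightarrow> 0" for c :: real
    by (rule LIMSEQ_ignore_initial_segment[OF lim_const_over_n])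
  have "(\<lambda>k. p k * (T / real (k + 1))) \<longlonglongrightarrow> 0"
  proof (rule Lim_null_comparison[OF _ const[of T]])
    have p: "p k \<in> {0..1}" for k
      unfolding p_def by (rule proportion_bounds[OF \<omega> i b])
    have "p k * (T / real (k + 1)) \<le> 1 * (T / real (k + 1))" for k
      using T p[of k] by (intro mult_right_mono) auto
    moreover have "0 \<le> p k" for k using p[of k] by simp
    ultimately show "\<forall>\<^sub>F k in sequentially. norm (p k * (T / real (k + 1))) \<le> T / real (k + 1)"
      using T by (simp add: abs_mult)
  qed
  moreover have "(\<lambda>k. \<Sum>j<N. d k j * R i $$ (j, b)) \<longlonglongrightarrow> (\<Sum>j<N. 0 * R i $$ (j, b))"
    using lln by (intro tendsto_sum tendsto_mult tendsto_const) (simp add: d_def[abs_def])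
  ultimately have "(\<lambda>k. C0 i $ b / real (k + 1) + (\<Sum>j<N. d k j * R i $$ (j, b))
      - p k * (T / real (k + 1))) \<longlonglongrightarrow> 0 + (\<Sum>j<N. 0 * R i $$ (j, b)) - 0"
    by (intro tendsto_add tendsto_diff const)
  then show ?thesis unfolding eq[symmetric] by (simp add: p_def i_def)
qed

text \<open>Draws of urn \<open>m\<close> in a round reach urn \<open>1\<close> for its next
  sampling, which is the index shift stated. For \<open>r < m\<close> the next urn is sampled later
  in the same round, so its proportion at \<open>k\<close> already matches the means at
  \<open>k\<close>; there the relation is moved up to \<open>k + 1\<close> and the means are moved
  back at vanishing cost.\<close>

lemma sampled_proportion_recursion_tendsto:
  assumes \<omega>: "\<omega> \<in> space M" and y: "y \<in> {1..m} \<times> {..<N}"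
    and lln: "\<And>r j. r \<in> {1..m} \<Longrightarrow> j < N \<Longrightarrow>
      (\<lambda>k. (\<Sum>q\<le>k. indicat_real {\<omega> \<in> space M. draw (m * q + r) \<omega> = j} \<omega>
        - sampled_proportion q (r, j) \<omega>) / real (k + 1)) \<longlonglongrightarrow> 0"
  shows "(\<lambda>k. sampled_proportion (Suc k) y \<omega>
    - (\<Sum>x\<in>{1..m} \<times> {..<N}. mean_proportion k x \<omega> * urn_kernel m R x y)) \<longlonglongrightarrow> 0"
proof -
  have "fst y \<in> {1..m}" using y by auto
  then obtain r where r: "r \<in> {1..m}" "fst y = next_urn m r"
    by (rule next_urn_surj)
  define b where "b = snd y"
  have yb: "y = (next_urn m r, b)" "b < N" using y r by (auto simp: b_def prod_eq_iff)
  define Q where "Q k = (\<Sum>j<N. mean_proportion k (r, j) \<omega> * R (next_urn m r) $$ (j, b))" for k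
  have Q: "(\<Sum>x\<in>{1..m} \<times> {..<N}. mean_proportion k x \<omega> * urn_kernel m R x y) = Q k" for k
    unfolding yb Q_def by (rule sum_urn_kernel_right[OF r(1)])
  have lim: "(\<lambda>k. proportion (C (m * k + r) (next_urn m r) \<omega>) b - Q k) \<longlonglongrightarrow> 0"
    unfolding Q_def using lln r yb \<omega> by (intro proportion_next_urn_tendsto) auto
  show ?thesis
  proof (cases "r = m")
    case True
    have "sampled_proportion (Suc k) y \<omega> = proportion (C (m * k + r) (next_urn m r) \<omega>) b" for k
      using True by (simp add: sampled_proportion_def yb next_urn_def add.commute)
    then show ?thesis using lim unfolding Q by simp
  next
    case False
    have eq: "sampled_proportion k y \<omega> = proportion (C (m * k + r) (next_urn m r) \<omega>) b" for k
      using False by (simp add: sampled_proportion_def yb next_urn_def)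
    have Qd: "Q (Suc k) - Q k = (\<Sum>j<N. (mean_proportion (Suc k) (r, j) \<omega> - mean_proportion k (r, j) \<omega>)
        * R (next_urn m r) $$ (j, b))" for k
      by (simp add: Q_def sum_subtractf left_diff_distrib)
    have "(\<lambda>k. Q (Suc k) - Q k) \<longlonglongrightarrow> (\<Sum>j<N. 0 * R (next_urn m r) $$ (j, b))"
      unfolding Qd using r \<omega>
      by (intro tendsto_sum tendsto_mult tendsto_const mean_proportion_diff_tendsto_0) auto
    from tendsto_add[OF LIMSEQ_Suc[OF lim] this] show ?thesis
      unfolding Q by (simp add: eq)
  qed
qed

text \<open>The running means converge by the contraction argument. Their limit, put into the
  recursion and combined with stationarity of \<open>\<mu>\<close>, gives the limit of the
  proportions themselves.\<close>

lemma sampled_proportion_tendsto: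
  assumes \<omega>: "\<omega> \<in> space M" and y: "y \<in> {1..m} \<times> {..<N}"
    and lln: "\<And>r j. r \<in> {1..m} \<Longrightarrow> j < N \<Longrightarrow>
      (\<lambda>k. (\<Sum>q\<le>k. indicat_real {\<omega> \<in> space M. draw (m * q + r) \<omega> = j} \<omega>
        - sampled_proportion q (r, j) \<omega>) / real (k + 1)) \<longlonglongrightarrow> 0"
    and \<mu>: "kernel.stationary \<mu>" "\<And>x. x \<in> {1..m} \<times> {..<N} \<Longrightarrow> 0 < \<mu> x"
      "\<And>i. i \<in> {1..m} \<Longrightarrow> (\<Sum>j<N. \<mu> (i, j)) = 1"
  shows "(\<lambda>k. sampled_proportion k y \<omega>) \<longlonglongrightarrow> \<mu> y"
proof -
  have "(\<Sum>x\<in>{1..m} \<times> {..<N}. \<mu> x) = (\<Sum>i\<in>{1..m}. \<Sum>j<N. \<mu> (i, j))"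
    by (simp add: sum.cartesian_product case_prod_beta)
  then have mass: "(\<Sum>x\<in>{1..m} \<times> {..<N}. \<mu> x) = real m" using \<mu>(3) by simp
  note rec = sampled_proportion_recursion_tendsto[OF \<omega> _ lln]
  have mean: "(\<lambda>k. mean_proportion k x \<omega>) \<longlonglongrightarrow> \<mu> x" if "x \<in> {1..m} \<times> {..<N}" for x
  proof (rule kernel.averages_tendsto_stationary[where x="\<lambda>k x. sampled_proportion k x \<omega>", OF \<mu>(1,2)])
    show "(\<Sum>a\<in>{1..m} \<times> {..<N}. mean_proportion k a \<omega>) = sum \<mu> ({1..m} \<times> {..<N})" for k
      unfolding mass by (rule sum_mean_proportion[OF \<omega>])
  qed (use that rec \<omega> in \<open>blast intro: sampled_proportion_bounds mean_proportion_bounds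
      mean_proportion_Suc\<close>)+
  have "(\<lambda>k. \<Sum>x\<in>{1..m} \<times> {..<N}. mean_proportion k x \<omega> * urn_kernel m R x y)
      \<longlonglongrightarrow> (\<Sum>x\<in>{1..m} \<times> {..<N}. \<mu> x * urn_kernel m R x y)"
    by (intro tendsto_sum tendsto_mult tendsto_const mean)
  also have "(\<Sum>x\<in>{1..m} \<times> {..<N}. \<mu> x * urn_kernel m R x y) = \<mu> y"
    using \<mu>(1) y unfolding kernel.stationary_def by blast
  finally have "(\<lambda>k. sampled_proportion (Suc k) y \<omega>) \<longlonglongrightarrow> \<mu> y"
    using tendsto_add[OF rec[OF y]] by fastforce
  then show ?thesis by (rule LIMSEQ_imp_Suc)
qed

text \<open>Urn 1 is fed at the end of a round and has received \<open>k\<close> rows at this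
  moment; every other urn has already been fed in the current round.\<close>

lemma total_before_sampling:
  assumes "\<omega> \<in> space M" "i \<in> {1..m}"
  shows "(\<Sum>j<N. C (m * k + i - 1) i \<omega> $ j) =
    (\<Sum>j<N. C0 i $ j) + (if i = 1 then real k else real k + 1)"
proof (cases "i = 1")
  case False
  then have "i - 1 \<in> {1..m}" "next_urn m (i - 1) = i" "m * k + (i - 1) = m * k + i - 1"
    using assms by (auto simp: next_urn_def)
  then show ?thesis using total_next_urn[OF assms(1), of "i - 1" k] False by simp
next
  case True
  show ?thesis
  proof (cases k)
    case 0
    then show ?thesis using True assms by (simp add: composition_0)
  next
    case (Suc q)
    then show ?thesis
      using total_next_urn[OF assms(1), of m q] True m
      by (simp add: next_urn_def add.commute)
  qed
qed

lemma scaled_composition_tendsto: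
  assumes \<omega>: "\<omega> \<in> space M" and i: "i \<in> {1..m}" and j: "j < N"
    and lim: "(\<lambda>k. sampled_proportion k (i, j) \<omega>) \<longlonglongrightarrow> l"
  shows "(\<lambda>t. scaled_composition m C t i \<omega> $ j) \<longlonglongrightarrow> l"
proof -
  define T where "T k = (\<Sum>j<N. C (m * k + i - 1) i \<omega> $ j)" for k
  \<comment> \<open>The bounded discrepancy between the total and the scaling factor
    \<open>k + 1\<close>; urn 1 lags by one row.\<close>
  define c where "c = (\<Sum>j<N. C0 i $ j) - (if i = 1 then 1 else 0)"
  have T: "T k = c + real (k + 1)" for k
    using total_before_sampling[OF \<omega> i, of k] by (simp add: T_def c_def)
  have eq: "scaled_composition m C (Suc k) i \<omega> $ j = sampled_proportion k (i, j) \<omega> * (c / real (k + 1) + 1)" for k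
  proof -
    have "C (m * k + i - 1) i \<omega> $ j = sampled_proportion k (i, j) \<omega> * T k"
      using total_pos[OF \<omega> i, of "m * k + i - 1"] \<omega> i
      by (simp add: sampled_proportion_def proportion_eq T_def)
    then show ?thesis
      using dim_composition[OF \<omega> i, of "m * k + i - 1"] j
      by (simp add: scaled_composition_def T field_simps)
  qed
  have "(\<lambda>k. c / real (k + 1)) \<longlonglongrightarrow> 0"
    by (rule LIMSEQ_ignore_initial_segment[OF lim_const_over_n])
  then have "(\<lambda>k. sampled_proportion k (i, j) \<omega> * (c / real (k + 1) + 1)) \<longlonglongrightarrow> l * (0 + 1)"
    by (intro tendsto_mult lim tendsto_add tendsto_const)
  then have "(\<lambda>k. scaled_composition m C (Suc k) i \<omega> $ j) \<longlonglongrightarrow> l" by (simp add: eq)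
  then show ?thesis by (rule LIMSEQ_imp_Suc)
qed

end

theorem theorem1:
  fixes m N :: nat
    and M :: "'a measure"
    and F :: "nat \<Rightarrow> 'a measure"
    and R :: "nat \<Rightarrow> real mat"
    and C0 :: "nat \<Rightarrow> real vec"
    and draw :: "nat \<Rightarrow> 'a \<Rightarrow> nat"
    and C :: "nat \<Rightarrow> nat \<Rightarrow> 'a \<Rightarrow> real vec"
  assumes m: "m \<ge> 1" and N: "N \<ge> 1"
    and model: "cyclic_urn_model M F m N R C0 draw C"
    and init_nonempty: "\<And>i. i \<in> {1..m} \<Longrightarrow> (\<Sum>j<N. C0 i $ j) > 0"
    and nonneg: "\<And>i a b. i \<in> {1..m} \<Longrightarrow> a < N \<Longrightarrow> b < N \<Longrightarrow> R i $$ (a, b) \<ge> 0"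
    and row_sum: "\<And>i a. i \<in> {1..m} \<Longrightarrow> a < N \<Longrightarrow> (\<Sum>b<N. R i $$ (a, b)) = 1"
    and irreducible: "irreducible_nonneg_mat (cyclic_block_mat m N R)"
    and i: "i \<in> {1..m}"
  shows "(\<exists>!v. normalized_left_eigenvector_1 (cyclic_prod m N R i) v) \<and>
    (AE \<omega> in M. \<forall>j<N.
      (\<lambda>t. scaled_composition m C t i \<omega> $ j)
        \<longlonglongrightarrow> left_eigenvector_pi (cyclic_prod m N R i) $ j) \<and>
    (\<forall>j<N. left_eigenvector_pi (cyclic_prod m N R i) $ j > 0)"
proof -
  interpret model: cyclic_urn_model M F m N R C0 draw C by (rule model)
  interpret stochastic_cyclic_urn M F m N R C0 draw C
    by unfold_locales
      (use m N model.replacement_carrier nonneg row_sum irreducible init_nonempty in auto)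
  obtain \<mu> where \<mu>: "kernel.stationary \<mu>" "\<And>x. x \<in> {1..m} \<times> {..<N} \<Longrightarrow> 0 < \<mu> x"
      "\<And>i. i \<in> {1..m} \<Longrightarrow> (\<Sum>j<N. \<mu> (i, j)) = 1"
    using stationary_distribution_exists by blast
  note iff = normalized_left_eigenvector_cyclic_prod_iff[OF i \<mu>(1,2) \<mu>(3)[OF i]]
  have pi: "left_eigenvector_pi (cyclic_prod m N R i) = vec N (\<lambda>j. \<mu> (i, j))"
    unfolding left_eigenvector_pi_def by (rule the_equality) (simp_all only: iff)
  \<comment> \<open>There are finitely many pairs of urn and colour, so one null set serves all of
    them and the rest is deterministic for each remaining outcome.\<close>
  have "AE \<omega> in M. \<forall>r\<in>{1..m}. \<forall>j\<in>{..<N}.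
      (\<lambda>k. (\<Sum>q\<le>k. indicat_real {\<omega> \<in> space M. draw (m * q + r) \<omega> = j} \<omega>
        - sampled_proportion q (r, j) \<omega>) / real (k + 1)) \<longlonglongrightarrow> 0"
    by (intro AE_finite_allI) (use draws_law_of_large_numbers in auto)
  then have "AE \<omega> in M. \<forall>j<N. (\<lambda>t. scaled_composition m C t i \<omega> $ j) \<longlonglongrightarrow> \<mu> (i, j)"
    using AE_space
  proof eventually_elim
    case (elim \<omega>)
    show ?case
    proof (intro allI impI)
      fix j assume j: "j < N"
      show "(\<lambda>t. scaled_composition m C t i \<omega> $ j) \<longlonglongrightarrow> \<mu> (i, j)"
        using elim i j by (intro scaled_composition_tendsto sampled_proportion_tendsto \<mu>) auto
    qed
  qed
  moreover have "\<exists>!v. normalized_left_eigenvector_1 (cyclic_prod m N R i) v"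
    by (rule ex1I[of _ "vec N (\<lambda>j. \<mu> (i, j))"]) (simp_all only: iff)
  ultimately show ?thesis using \<mu>(2) i by (simp add: pi)
qed

end
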